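(* Let $K$ be a field, let $G$ be a finite connected simple graph with at least one edge, and let $K[G]$ be its edge ring. If $K[G]$ has a $3$-linear resolution, then $K[G]$ is a hypersurface.
   Context: Let $G$ have vertex set $[N]=\{1,\dots,N\}$ and edge set $E(G)=\{e_1,\dots,e_n\}$, let $\mathbf e_1,\dots,\mathbf e_N$ be the standard basis of $\mathbb R^N$, and for an edge $e=\{i,j\}$ put $\rho(e)=\mathbf e_i+\mathbf e_j$. Let $K[t_1^{\pm1},\dots,t_N^{\pm1},s]$ be the Laurent polynomial ring (with $s$ not inverted), and write $\mathbf t^{\mathbf a}=t_1^{a_1}\cdots t_N^{a_N}$. The edge ring $K[G]$ is the $K$-subalgebra generated by the monomials $\mathbf t^{\rho(e_1)}s,\dots,\mathbf t^{\rho(e_n)}s$. Let $S=K[x_1,\dots,x_n]$ with each $\deg x_i=1$, and let $\pi:S\to K[G]$ be the surjective $K$-algebra homomorphism with $\pi(x_i)=\mathbf t^{\rho(e_i)}s$. The toric ideal is $I_G=\ker\pi$, a homogeneous ideal, so $K[G]\cong S/I_G$. For a homogeneous ideal $I\subset S$, let $\beta_{i,j}=\dim_K \operatorname{Tor}^S_i(S/I,K)_j$ be the graded Betti numbers of $S/I$, i.e. the minimal graded free $S$-resolution of $S/I$ has $i$-th module $\bigoplus_j S(-j)^{\beta_{i,j}}$. $S/I$ has a $q$-linear resolution if $\beta_{i,j}=0$ for every $i\ge 1$ and every $j\ne q+i-1$. "$K[G]$ has a $q$-linear resolution" refers to $S/I_G$. $K[G]$ is a hypersurface if $I_G$ is a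 principal ideal of $S$ (the zero ideal being regarded as principal). *)

theory Defs
  imports
    "HOL-Library.Poly_Mapping"
    "HOL-Library.Product_Plus"
    "Jordan_Normal_Form.Matrix"
begin

section \<open>Finite simple graphs\<close>

text \<open>An edge is the two-element set of its end points, so loops and multiple edges are excluded.\<close>

definition finite_simple_graph :: "'v set \<Rightarrow> 'v set set \<Rightarrow> bool" where
  "finite_simple_graph V E \<longleftrightarrow> finite V \<and> (\<forall>e\<in>E. e \<subseteq> V \<and> card e = 2)"

definition connected_graph :: "'v set \<Rightarrow> 'v set set \<Rightarrow> bool" where
  "connected_graph V E \<longleftrightarrow>
     V \<noteq> {} \<and> (\<forall>u\<in>V. \<forall>v\<in>V. (u, v) \<in> {(a, b). {a, b} \<in> E}\<^sup>*)"


section \<open>Polynomial rings\<close>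

abbreviation (input) keys where "keys \<equiv> Poly_Mapping.keys"
abbreviation (input) lookup where "lookup \<equiv> Poly_Mapping.lookup"

type_synonym 'x monom = "'x \<Rightarrow>\<^sub>0 nat"
type_synonym ('x, 'k) mpoly = "('x \<Rightarrow>\<^sub>0 nat) \<Rightarrow>\<^sub>0 'k"

definition mdeg :: "'x monom \<Rightarrow> nat" where
  "mdeg m = (\<Sum>x\<in>keys m. lookup m x)"

definition poly_ring :: "'x set \<Rightarrow> ('x, 'k::zero) mpoly set" where
  "poly_ring X = {p. \<forall>m\<in>keys p. keys m \<subseteq> X}"

text \<open>Degrees are integers because differences of twists occur below; the zero polynomial is
  homogeneous of every degree, and it is the only one that is homogeneous of a negative degree.\<close>

definition homogeneous :: "int \<Rightarrow> ('x, 'k::zero) mpoly \<Rightarrow> bool" where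
  "homogeneous d p \<longleftrightarrow> (\<forall>m\<in>keys p. int (mdeg m) = d)"

definition principal_ideal_of :: "('x, 'k::comm_ring_1) mpoly set \<Rightarrow> ('x, 'k) mpoly set \<Rightarrow> bool" where
  "principal_ideal_of S I \<longleftrightarrow> (\<exists>f\<in>S. I = (\<lambda>g. g * f) ` S)"


section \<open>Edge rings and toric ideals\<close>

text \<open>The Laurent polynomial ring with an extra, non-inverted variable \<open>s\<close>: the monomial
  \<open>t\<^sup>a s\<^sup>k\<close> is the pair \<open>(a, k)\<close>.\<close>

type_synonym ('v, 'k) laurent = "(('v \<Rightarrow>\<^sub>0 int) \<times> nat) \<Rightarrow>\<^sub>0 'k"

definition \<rho> :: "'v set \<Rightarrow> 'v \<Rightarrow>\<^sub>0 int" where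
  "\<rho> e = (\<Sum>v\<in>e. Poly_Mapping.single v 1)"

definition edge_monomial :: "'v set \<Rightarrow> ('v, 'k::comm_ring_1) laurent" where
  "edge_monomial e = Poly_Mapping.single (\<rho> e, 1) 1"

inductive_set edge_ring :: "'v set set \<Rightarrow> ('v, 'k::comm_ring_1) laurent set"
  for E :: "'v set set" where
  const: "Poly_Mapping.single 0 c \<in> edge_ring E"
| gen: "e \<in> E \<Longrightarrow> edge_monomial e \<in> edge_ring E"
| add: "\<lbrakk>p \<in> edge_ring E; q \<in> edge_ring E\<rbrakk> \<Longrightarrow> p + q \<in> edge_ring E"
| mult: "\<lbrakk>p \<in> edge_ring E; q \<in> edge_ring E\<rbrakk> \<Longrightarrow> p * q \<in> edge_ring E"

text \<open>The variables of \<open>S\<close> are the edges themselves instead of \<open>x\<^sub>1, \<dots>, x\<^sub>n\<close>.\<close>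

definition toric_map :: "('v set, 'k::comm_ring_1) mpoly \<Rightarrow> ('v, 'k) laurent" where
  "toric_map p =
     (\<Sum>m\<in>keys p. Poly_Mapping.single 0 (lookup p m) * (\<Prod>e\<in>keys m. edge_monomial e ^ lookup m e))"

definition toric_ideal :: "'v set set \<Rightarrow> ('v set, 'k::comm_ring_1) mpoly set" where
  "toric_ideal E = {p \<in> poly_ring E. toric_map p = 0}"


subsection \<open>The toric map is an algebra homomorphism onto the edge ring\<close>

definition toric_monom :: "'v set monom \<Rightarrow> ('v, 'k::comm_ring_1) laurent" where
  "toric_monom m = (\<Prod>e\<in>keys m. edge_monomial e ^ lookup m e)"

lemma toric_monom_superset:
  assumes "finite A" "keys m \<subseteq> A"
  shows "toric_monom m = (\<Prod>e\<in>A. edge_monomial e ^ lookup m e)"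
  unfolding toric_monom_def using assms
  by (intro prod.mono_neutral_left) (auto simp: in_keys_iff)

lemma toric_monom_add: "toric_monom (m + n) = toric_monom m * toric_monom n"
proof -
  have sub: "keys (m + n) \<subseteq> keys m \<union> keys n"
    by (rule Poly_Mapping.keys_add)
  show ?thesis
    by (simp add: toric_monom_superset[OF _ sub] lookup_add power_add prod.distrib
        toric_monom_superset[of "keys m \<union> keys n" m, symmetric]
        toric_monom_superset[of "keys m \<union> keys n" n, symmetric])
qed

lemma toric_map_superset:
  assumes "finite A" "keys p \<subseteq> A"
  shows "toric_map p = (\<Sum>m\<in>A. Poly_Mapping.single 0 (lookup p m) * toric_monom m)"
  unfolding toric_map_def toric_monom_def[symmetric] using assms
  by (intro sum.mono_neutral_left) (auto simp: in_keys_iff)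

lemma toric_map_0 [simp]: "toric_map 0 = 0"
  by (simp add: toric_map_def)

lemma toric_map_add: "toric_map (p + q) = toric_map p + toric_map q"
proof -
  have sub: "keys (p + q) \<subseteq> keys p \<union> keys q"
    by (rule Poly_Mapping.keys_add)
  show ?thesis
    using toric_map_superset[of "keys p \<union> keys q" p] toric_map_superset[of "keys p \<union> keys q" q]
      toric_map_superset[OF _ sub]
    by (simp add: lookup_add single_add distrib_right sum.distrib)
qed

lemma toric_map_sum: "toric_map (sum f A) = (\<Sum>a\<in>A. toric_map (f a))"
  by (induction A rule: infinite_finite_induct) (auto simp: toric_map_add)

lemma toric_map_single:
  "toric_map (Poly_Mapping.single m c) = Poly_Mapping.single 0 c * toric_monom m"
  using toric_map_superset[of "{m}" "Poly_Mapping.single m c"] by (simp split: if_splits)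

lemma mpoly_sum_single: "p = (\<Sum>m\<in>keys p. Poly_Mapping.single m (lookup p m))"
  by (rule poly_mapping_eqI)
    (auto simp: lookup_sum lookup_single when_def in_keys_iff)

lemma single_0_mult:
  "Poly_Mapping.single (0::'a::comm_monoid_add) (a * b :: 'k::comm_ring_1) =
     Poly_Mapping.single 0 a * Poly_Mapping.single 0 b"
  by (simp add: mult_single)

lemma toric_map_mult: "toric_map (p * q) = toric_map p * toric_map q"
proof -
  have "p * q = (\<Sum>m\<in>keys p. \<Sum>n\<in>keys q.
      Poly_Mapping.single (m + n) (lookup p m * lookup q n))"
    by (subst mpoly_sum_single[of p], subst mpoly_sum_single[of q])
      (simp add: sum_product mult_single)
  then show ?thesis
    by (simp add: toric_map_sum toric_map_single toric_monom_add)
      (simp add: toric_map_def toric_monom_def[symmetric] sum_product single_0_mult mult_ac)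
qed

lemma toric_monom_edge: "toric_monom (Poly_Mapping.single e 1) = edge_monomial e"
  by (simp add: toric_monom_def)

lemma toric_map_const: "toric_map (Poly_Mapping.single 0 c) = Poly_Mapping.single 0 c"
  by (simp add: toric_map_single toric_monom_def)

lemma toric_map_var:
  "toric_map (Poly_Mapping.single (Poly_Mapping.single e 1) 1) = edge_monomial e"
  by (simp only: toric_map_single toric_monom_edge single_one mult_1_left)

lemma poly_ring_add: "p \<in> poly_ring X \<Longrightarrow> q \<in> poly_ring X \<Longrightarrow> p + q \<in> poly_ring X"
  using Poly_Mapping.keys_add[of p q] by (auto simp: poly_ring_def)

lemma poly_ring_mult:
  fixes p q :: "('x, 'k::comm_ring_1) mpoly"
  assumes "p \<in> poly_ring X" "q \<in> poly_ring X"
  shows "p * q \<in> poly_ring X"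
proof -
  have "keys m \<subseteq> X" if m: "m \<in> keys (p * q)" for m
  proof -
    obtain a b where "m = a + b" "a \<in> keys p" "b \<in> keys q"
      using m Poly_Mapping.keys_mult[of p q] by blast
    then show ?thesis
      using assms Poly_Mapping.keys_add[of a b] by (simp add: poly_ring_def) blast
  qed
  then show ?thesis by (auto simp: poly_ring_def)
qed

lemma edge_ring_power: "p \<in> edge_ring E \<Longrightarrow> p ^ n \<in> edge_ring E"
  by (induction n) (auto intro: edge_ring.mult edge_ring.const[of 1, simplified])

lemma edge_ring_prod: "(\<And>a. a \<in> A \<Longrightarrow> f a \<in> edge_ring E) \<Longrightarrow> prod f A \<in> edge_ring E"
  by (induction A rule: infinite_finite_induct)
    (auto intro: edge_ring.mult edge_ring.const[of 1, simplified])

lemma edge_ring_sum: "(\<And>a. a \<in> A \<Longrightarrow> f a \<in> edge_ring E) \<Longrightarrow> sum f A \<in> edge_ring E"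
  by (induction A rule: infinite_finite_induct)
    (auto intro: edge_ring.add edge_ring.const[of 0, simplified])

lemma toric_map_image:
  "(toric_map ` poly_ring E :: ('v, 'k::comm_ring_1) laurent set) = edge_ring E"
proof
  show "toric_map ` poly_ring E \<subseteq> (edge_ring E :: ('v, 'k) laurent set)"
    by (auto simp: toric_map_def poly_ring_def
        intro!: edge_ring_sum edge_ring.mult edge_ring.const edge_ring_prod edge_ring_power edge_ring.gen)
  have "p \<in> toric_map ` poly_ring E" if "p \<in> edge_ring E" for p :: "('v, 'k) laurent"
    using that
  proof induction
    case (const c)
    have "Poly_Mapping.single 0 c \<in> poly_ring E"
      by (auto simp: poly_ring_def)
    then show ?case
      by (metis toric_map_const image_eqI)
  next
    case (gen e)
    then have "Poly_Mapping.single (Poly_Mapping.single e 1) 1 \<in> poly_ring E"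
      by (auto simp: poly_ring_def)
    then show ?case
      by (metis toric_map_var image_eqI)
  next
    case (add p q)
    then show ?case
      by (auto simp: toric_map_add[symmetric] intro!: imageI poly_ring_add)
  next
    case (mult p q)
    then show ?case
      by (auto simp: toric_map_mult[symmetric] intro!: imageI poly_ring_mult)
  qed
  then show "(edge_ring E :: ('v, 'k) laurent set) \<subseteq> toric_map ` poly_ring E" by blast
qed


section \<open>Minimal graded free resolutions\<close>

text \<open>Throughout, \<open>S\<close> is \<open>poly_ring X\<close>. A finitely generated graded free module
  \<open>S(-d\<^sub>1) \<oplus> \<dots> \<oplus> S(-d\<^sub>r)\<close> is represented by the list of its twists, a map between two such
  modules by a matrix acting on column vectors.\<close>

definition free_module :: "('x, 'k::zero) mpoly set \<Rightarrow> nat \<Rightarrow> ('x, 'k) mpoly vec set" where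
  "free_module S r = {v \<in> carrier_vec r. set\<^sub>v v \<subseteq> S}"

text \<open>The matrix of a degree-preserving \<open>S\<close>-linear map from the module with twists \<open>ds'\<close> to the
  one with twists \<open>ds\<close>.\<close>

definition graded_matrix ::
    "('x, 'k::zero) mpoly set \<Rightarrow> int list \<Rightarrow> int list \<Rightarrow> ('x, 'k) mpoly mat \<Rightarrow> bool" where
  "graded_matrix S ds ds' A \<longleftrightarrow>
     A \<in> carrier_mat (length ds) (length ds') \<and>
     (\<forall>l<length ds. \<forall>k<length ds'. A $$ (l, k) \<in> S \<and> homogeneous (ds' ! k - ds ! l) (A $$ (l, k)))"

text \<open>A graded free resolution \<open>\<dots> \<rightarrow> F 2 \<rightarrow> F 1 \<rightarrow> F 0 = S \<rightarrow> S/I \<rightarrow> 0\<close>, where \<open>F i\<close> has twists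
  \<open>tw i\<close> and \<open>D i\<close> is the matrix of the differential from \<open>F (Suc i)\<close> to \<open>F i\<close>. The augmentation
  \<open>F 0 \<rightarrow> S/I\<close> is the projection; exactness at \<open>F 0\<close> says that its kernel \<open>I\<close> is the image
  of \<open>D 0\<close>. Finite length is not imposed; \<open>F i = 0\<close> is allowed.\<close>

definition graded_free_resolution ::
    "'x set \<Rightarrow> ('x, 'k::comm_ring_1) mpoly set \<Rightarrow>
     (nat \<Rightarrow> int list) \<Rightarrow> (nat \<Rightarrow> ('x, 'k) mpoly mat) \<Rightarrow> bool" where
  "graded_free_resolution X I tw D \<longleftrightarrow>
     (let S = poly_ring X; F = (\<lambda>i. free_module S (length (tw i))) in
       tw 0 = [0] \<and>
       (\<forall>i. graded_matrix S (tw i) (tw (Suc i)) (D i)) \<and>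
       (\<lambda>v. D 0 *\<^sub>v v) ` F 1 = {w \<in> F 0. w $ 0 \<in> I} \<and>
       (\<forall>i. (\<lambda>v. D (Suc i) *\<^sub>v v) ` F (Suc (Suc i)) =
            {w \<in> F (Suc i). D i *\<^sub>v w = 0\<^sub>v (length (tw i))}))"

text \<open>Minimality: the image of every differential lies in the graded maximal ideal times the
  target, i.e. no matrix entry has a constant term. For a proper homogeneous ideal \<open>I\<close> such a
  resolution of \<open>S/I\<close> exists (with \<open>F 0 = S\<close>) and is unique up to isomorphism when \<open>X\<close> is finite
  and the coefficients form a field.\<close>

definition minimal_graded_free_resolution ::
    "'x set \<Rightarrow> ('x, 'k::comm_ring_1) mpoly set \<Rightarrow>
     (nat \<Rightarrow> int list) \<Rightarrow> (nat \<Rightarrow> ('x, 'k) mpoly mat) \<Rightarrow> bool" where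
  "minimal_graded_free_resolution X I tw D \<longleftrightarrow>
     graded_free_resolution X I tw D \<and>
     (\<forall>i. \<forall>l<length (tw i). \<forall>k<length (tw (Suc i)). lookup (D i $$ (l, k)) 0 = 0)"

text \<open>The graded Betti number \<open>\<beta>\<^sub>i\<^sub>,\<^sub>j\<close>, read off the twists of the minimal resolution: the
  multiplicity of \<open>S(-j)\<close> as a summand of \<open>F i\<close>.\<close>

definition graded_betti :: "(nat \<Rightarrow> int list) \<Rightarrow> nat \<Rightarrow> int \<Rightarrow> nat" where
  "graded_betti tw i j = count_list (tw i) j"

definition has_linear_resolution ::
    "nat \<Rightarrow> 'x set \<Rightarrow> ('x, 'k::comm_ring_1) mpoly set \<Rightarrow> bool" where
  "has_linear_resolution q X I \<longleftrightarrow>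
     (\<exists>tw D. minimal_graded_free_resolution X I tw D \<and>
       (\<forall>i\<ge>1. \<forall>j. j \<noteq> int q + int i - 1 \<longrightarrow> graded_betti tw i j = 0))"

end

theory Submission
  imports
    Defs
    "HOL-Library.Multiset"
begin

text \<open>Suppose \<open>I\<^sub>G\<close> is generated by cubics with linear first syzygies. Having no quadrics, \<open>I\<^sub>G\<close>
  forces \<open>G\<close> to have no 4-cycle, and a cubic binomial is an even closed walk of length six: a hexagon
  or two triangles sharing a vertex. Fix a monomial \<open>u\<close> of a cubic generator \<open>g\<close> and let \<open>X\<close> be the set of
  variables occurring in the coefficient of \<open>u\<close> in the linear syzygies, i.e. in
  \<open>\<Sum>\<^sub>j [u]f\<^sub>j \<cdot> l\<^sub>j\<close> for the syzygies \<open>\<Sum>\<^sub>j f\<^sub>j l\<^sub>j = 0\<close>.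

  If \<open>h\<close> is a cubic in \<open>I\<^sub>G\<close> without the monomial \<open>u\<close>, the Koszul syzygy of \<open>g\<close> and \<open>h\<close> is a combination of
  linear ones, so every monomial of \<open>h\<close> is divisible by a variable in \<open>X\<close>. Conversely, for \<open>e \<in> X\<close>
  the coefficient of \<open>x\<^sub>e u\<close> in a linear syzygy shows that replacing some edge of \<open>u\<close> by \<open>e\<close> gives again
  half of a cubic binomial; by the first property its other half contains an edge of \<open>X\<close> too.

  If \<open>I\<^sub>G\<close> is not principal, then \<open>X \<noteq> {}\<close>, and the replacement can be iterated. Let \<open>C\<close> be the vertex
  set of the closed walk through \<open>u\<close>. No edge of \<open>X\<close> lies inside \<open>C\<close>; hence two steps produce two edges of
  \<open>X\<close> joining the same outside vertex to distinct vertices of \<open>C\<close>. Such an edge only exists if the walk is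
  a hexagon with a chord in the parity class of its end point, and two of them create a 4-cycle.\<close>

section \<open>Closed walks of length six\<close>

definition edge_degree :: "'v set multiset \<Rightarrow> 'v \<Rightarrow> nat" where
  "edge_degree M v = (\<Sum>e\<in>#M. of_bool (v \<in> e))"

lemma edge_degree_simps [simp]:
  "edge_degree {#} v = 0"
  "edge_degree (add_mset e M) v = of_bool (v \<in> e) + edge_degree M v"
  by (simp_all add: edge_degree_def)

lemma edge_degree_posD:
  assumes "edge_degree M v > 0"
  obtains e M' where "M = add_mset e M'" "v \<in> e"
proof -
  have "\<exists>e\<in>#M. v \<in> e"
    using assms by (induction M) (auto split: if_splits)
  then show thesis using that by (metis multi_member_split)
qed

lemma card_2_other: "card e = 2 \<Longrightarrow> v \<in> e \<Longrightarrow> \<exists>w. e = {v, w} \<and> w \<noteq> v"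
  by (auto simp: card_2_iff)

lemma two_element_mset_eq_iff: "{#x, y#} = {#x', y'#} \<longleftrightarrow> x = x' \<and> y = y' \<or> x = y' \<and> y = x'"
  by (auto simp: add_eq_conv_ex)

text \<open>Equal degrees allow the walk to be followed from \<open>{v0, v1}\<close> in both
  directions, with edges of \<open>N\<close> and \<open>M\<close> in turn. Disjointness keeps it
  from turning back, and the degree count determines the last edge of either side.\<close>

lemma cubic_fibre_walk:
  assumes "size M = 3" "size N = 3" and card: "\<And>e. e \<in># M + N \<Longrightarrow> card e = 2"
    and deg: "\<And>v. edge_degree M v = edge_degree N v"
    and disj: "set_mset M \<inter> set_mset N = {}"
    and p: "{v0, v1} \<in># M"
  obtains v2 v3 v4 v5 where "M = {#{v0, v1}, {v2, v3}, {v4, v5}#}" "N = {#{v1, v2}, {v3, v4}, {v5, v0}#}"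
proof -
  have v01: "v0 \<noteq> v1" using card[of "{v0,v1}"] p by auto
  obtain M' where M': "M = add_mset {v0,v1} M'" using p by (metis multi_member_split)
  have "edge_degree N v1 > 0" using deg[of v1] M' by auto
  then obtain x N' where x: "N = add_mset x N'" "v1 \<in> x" by (rule edge_degree_posD)
  then obtain v2 where v2: "x = {v1, v2}" "v2 \<noteq> v1" using card_2_other[of x v1] card[of x] by auto
  have v20: "v2 \<noteq> v0" using v2 x M' disj by (auto simp: insert_commute)
  have "edge_degree M' v2 > 0" using deg[of v2] M' x v2 v20 by auto
  then obtain q M2 where q: "M' = add_mset q M2" "v2 \<in> q" by (rule edge_degree_posD)
  then obtain v3 where v3: "q = {v2, v3}" "v3 \<noteq> v2" using card_2_other[of q v2] card[of q] M' by auto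
  have v31: "v3 \<noteq> v1" using v2 v3 x q M' disj by (auto simp: insert_commute)
  have "size M2 = 1" using assms(1) M' q by simp
  then obtain r where r: "M2 = {#r#}" using size_1_singleton_mset by blast
  have "edge_degree N' v0 > 0" using deg[of v0] M' x v2 v20 v01 by auto
  then obtain y N2 where y: "N' = add_mset y N2" "v0 \<in> y" by (rule edge_degree_posD)
  then obtain v5 where v5: "y = {v0, v5}" "v5 \<noteq> v0" using card_2_other[of y v0] card[of y] x by auto
  have v51: "v5 \<noteq> v1" using v5 y x M' disj by (auto simp: insert_commute)
  have "size N2 = 1" using assms(2) x y by simp
  then obtain z where z: "N2 = {#z#}" using size_1_singleton_mset by blast
  \<comment> \<open>Cancelling the known ends \<open>v0\<close>, \<open>v1\<close>,
    \<open>v2\<close> leaves \<open>v3\<close> and the last edge \<open>r\<close> against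
    \<open>v5\<close> and the last edge \<open>z\<close>.\<close>
  have eq: "of_bool (v = v3) + of_bool (v \<in> r) = of_bool (v = v5) + (of_bool (v \<in> z) :: nat)" for v
    using deg[of v] M' x q r y z v01 v2 v20 v3 v31 v5 v51 by (auto simp: of_bool_def split: if_splits)
  have rz: "r \<noteq> z" using disj M' x q r y z by auto
  \<comment> \<open>Otherwise \<open>r\<close> and \<open>z\<close> have the same ends and are a
    common edge of \<open>M\<close> and \<open>N\<close>.\<close>
  have "v5 \<noteq> v3"
  proof
    assume "v5 = v3"
    then have "v \<in> r \<longleftrightarrow> v \<in> z" for v using eq[of v] by (simp add: of_bool_eq_iff)
    then have "r = z" by blast
    with rz show False ..
  qed
  then have "v5 \<in> r" using eq[of v5] by (auto simp: of_bool_def split: if_splits)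
  then obtain v4 where v4: "r = {v5, v4}" "v4 \<noteq> v5" using card_2_other[of r v5] card[of r] M' q r by auto
  have "v \<in> z \<longleftrightarrow> v = v3 \<or> v = v4" for v
    using eq[of v] v4 \<open>v5 \<noteq> v3\<close> by (auto simp: of_bool_def split: if_splits)
  then have "z = {v3, v4}" by blast
  then show thesis
    using that[of v2 v3 v4 v5] M' q r x y z v2 v3 v4 v5 by (simp add: insert_commute)
qed

section \<open>Closed walks in graphs without 4-cycles\<close>

locale c4_free =
  fixes E :: "'v set set"
  assumes card_edge: "e \<in> E \<Longrightarrow> card e = 2"
    and no_c4: "{a, b} \<in> E \<Longrightarrow> {b, c} \<in> E \<Longrightarrow> {c, d} \<in> E \<Longrightarrow> {d, a} \<in> E \<Longrightarrow> a = c \<or> b = d"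
begin

definition adj :: "'v \<Rightarrow> 'v \<Rightarrow> bool" where
  "adj a b \<longleftrightarrow> {a, b} \<in> E"

lemma sym: "adj a b \<Longrightarrow> adj b a"
  by (simp add: adj_def insert_commute)

lemma irrefl: "\<not> adj a a"
  using card_edge by (force simp: adj_def)

lemma c4: "adj a b \<Longrightarrow> adj b c \<Longrightarrow> adj c d \<Longrightarrow> adj d a \<Longrightarrow> a = c \<or> b = d"
  unfolding adj_def by (rule no_c4)

text \<open>The inequalities say exactly that none of the edges \<open>{a,b}\<close>,
  \<open>{c,d}\<close>, \<open>{e,f}\<close> is among \<open>{b,c}\<close>, \<open>{d,e}\<close>,
  \<open>{f,a}\<close>. One pair of opposite vertices may coincide, as in two triangles sharing a
  vertex.\<close>

definition closed_walk6 where "closed_walk6 a b c d e f \<longleftrightarrow>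
  adj a b \<and> adj b c \<and> adj c d \<and> adj d e \<and> adj e f \<and> adj f a \<and>
  a \<noteq> c \<and> b \<noteq> d \<and> c \<noteq> e \<and> d \<noteq> f \<and> e \<noteq> a \<and> f \<noteq> b \<and>
  \<not> (a = d \<and> b = e) \<and> \<not> (b = e \<and> c = f) \<and> \<not> (c = f \<and> d = a)"

lemma closed_walk6_rotate: "closed_walk6 a b c d e f \<Longrightarrow> closed_walk6 b c d e f a"
  unfolding closed_walk6_def by blast

lemma closed_walk6_reverse: "closed_walk6 a b c d e f \<Longrightarrow> closed_walk6 f e d c b a"
  unfolding closed_walk6_def using sym by blast

lemma closed_walk6_rotate2: "closed_walk6 a b c d e f \<Longrightarrow> closed_walk6 c d e f a b"
  by (rule closed_walk6_rotate) (rule closed_walk6_rotate)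

lemma closed_walk6_flip: "closed_walk6 a b c d e f \<Longrightarrow> closed_walk6 d c b a f e"
  by (rule closed_walk6_rotate2) (rule closed_walk6_reverse)

text \<open>The chord would close the path \<open>a\<close>, \<open>b\<close>, \<open>c\<close>,
  \<open>d\<close> to a 4-cycle.\<close>

lemma no_antipodal_chord: "closed_walk6 a b c d e f \<Longrightarrow> \<not> adj a d"
  unfolding closed_walk6_def using c4 irrefl sym by metis

lemma unique_mid: "adj a x \<Longrightarrow> adj x b \<Longrightarrow> adj a y \<Longrightarrow> adj y b \<Longrightarrow> a \<noteq> b \<Longrightarrow> x = y"
  using c4[of a x b y] sym by blast

text \<open>In a hexagon, chords in both parity classes produce a 4-cycle; the conclusion is the degenerate
  case of two triangles sharing a vertex.\<close>

lemma chords: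
  assumes "closed_walk6 a b c d e f" "adj a c" "adj b d \<or> adj d f \<or> adj b f"
  shows "a = d \<or> b = e \<or> c = f"
  using assms unfolding closed_walk6_def using c4 irrefl sym by metis

text \<open>A new edge \<open>{v, w}\<close> in place of \<open>{e, f}\<close> closes up with \<open>{a, b}\<close> and \<open>{c, d}\<close> either along
  the walk edge \<open>{b, c}\<close> (parallel) or, up to symmetry, along a chord \<open>{b, d}\<close> (crossed).\<close>

lemma parallel_not_inside:
  assumes "closed_walk6 a b c d e f" "closed_walk6 a b c d v w" "{v,w} \<noteq> {e,f}" "v \<in> {a,b,c,d,e,f}" "w \<in> {a,b,c,d,e,f}"
  shows False
  using assms unfolding closed_walk6_def insert_iff empty_iff
  by (elim conjE disjE; metis c4 sym irrefl insert_commute)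

text \<open>The edge \<open>{d,v}\<close> rules out \<open>a\<close>, since \<open>{a,d}\<close> is
  no chord, and \<open>w\<close> outside the walk rules out \<open>e\<close>. What remains makes
  \<open>{d,v}\<close> a chord ending in \<open>b\<close> or \<open>f\<close>.\<close>

lemma parallel_contact:
  assumes 1: "closed_walk6 a b c d e f" and 2: "closed_walk6 a b c d v w"
    and v: "v \<in> {a,b,c,d,e,f}" and w: "w \<notin> {a,b,c,d,e,f}"
  shows "a \<noteq> d \<and> b \<noteq> e \<and> c \<noteq> f \<and> (v = b \<and> adj b d \<or> v = f \<and> adj d f)"
proof -
  have adj: "adj a b" "adj b c" "adj c d" "adj d e" "adj e f" "adj f a"
      "adj d v" "adj v w" "adj w a"
    and ne: "a \<noteq> c" "b \<noteq> d" "c \<noteq> e" "d \<noteq> f" "e \<noteq> a" "f \<noteq> b"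
      "\<not> (a = d \<and> b = e)" "\<not> (b = e \<and> c = f)" "\<not> (c = f \<and> d = a)"
      "c \<noteq> v"
    using 1 2 by (auto simp: closed_walk6_def)
  note rot = closed_walk6_rotate2[OF 1] closed_walk6_rotate2[OF closed_walk6_rotate2[OF 1]]
  note adj = adj adj[THEN sym]
  have "v \<noteq> a" using no_antipodal_chord[OF 1] adj by auto
  moreover have "v \<noteq> d" using irrefl adj by auto
  moreover have "v \<noteq> e" using unique_mid[of e f a w] adj ne w by auto
  ultimately have v': "v = b \<or> v = f" using v ne by auto
  \<comment> \<open>With \<open>a = d\<close>, the walk vertex \<open>c\<close> or \<open>e\<close>
    would be a common neighbour of \<open>a\<close> and \<open>v\<close> besides
    \<open>w\<close>.\<close>
  moreover have "a \<noteq> d"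
    using v' unique_mid[of a w b c] unique_mid[of a w f e] adj ne w irrefl by auto
  moreover have "b \<noteq> e"
    using v' \<open>v \<noteq> e\<close> unique_mid[of f d b a] adj ne irrefl \<open>a \<noteq> d\<close> by auto
  moreover have "c \<noteq> f"
    using v' unique_mid[of b a c d] adj ne irrefl \<open>a \<noteq> d\<close> by auto
  ultimately show ?thesis using adj by auto
qed

text \<open>Besides the positions that the second walk itself excludes, \<open>v\<close> off
  \<open>b\<close> would make \<open>{c,v}\<close> a loop, an antipodal chord, or a chord
  \<open>{c,e}\<close> in the parity class opposite to that of the chord
  \<open>{b,d}\<close>.\<close>

lemma crossed_meeting:
  assumes 1: "closed_walk6 a b c d e f" and 2: "closed_walk6 a b d c v w"
  shows "c \<noteq> f" "v \<in> {a,b,c,d,e,f} \<Longrightarrow> v = b"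
proof -
  have adj: "adj a b" "adj b c" "adj c d" "adj d e" "adj e f" "adj f a"
      "adj b d" "adj c v" "adj v w" "adj w a"
    and ne: "a \<noteq> c" "b \<noteq> d" "c \<noteq> e" "d \<noteq> f" "e \<noteq> a" "f \<noteq> b"
      "\<not> (a = d \<and> b = e)" "\<not> (b = e \<and> c = f)" "\<not> (c = f \<and> d = a)"
      "a \<noteq> d" "v \<noteq> a" "v \<noteq> d"
    using 1 2 by (auto simp: closed_walk6_def)
  note rot = closed_walk6_rotate2[OF 1] closed_walk6_rotate2[OF closed_walk6_rotate2[OF 1]]
  note adj = adj adj[THEN sym]
  show cf: "c \<noteq> f"
    using unique_mid[of b a c d] adj ne irrefl by auto
  have "e = v \<Longrightarrow> e = b"
    using chords[OF rot(1)] adj ne cf by blast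
  moreover have "v \<noteq> f" using no_antipodal_chord[OF rot(1)] adj by blast
  moreover have "v \<noteq> c" using adj irrefl by auto
  ultimately show "v \<in> {a,b,c,d,e,f} \<Longrightarrow> v = b" using ne by auto
qed

text \<open>Once \<open>v = b\<close>, \<open>w\<close> is a common neighbour of \<open>a\<close>
  and \<open>b\<close>; with \<open>b = e\<close> the vertex \<open>f\<close> would be another
  one.\<close>

lemma crossed_contact_left:
  assumes 1: "closed_walk6 a b c d e f" and 2: "closed_walk6 a b d c v w"
    and v: "v \<in> {a,b,c,d,e,f}" and w: "w \<notin> {a,b,c,d,e,f}"
  shows "a \<noteq> d \<and> b \<noteq> e \<and> c \<noteq> f \<and> v = b \<and> adj b d"
proof -
  have b: "v = b" and cf: "c \<noteq> f" using crossed_meeting[OF 1 2] v by auto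
  have "b \<noteq> e"
    using unique_mid[of a w b f] 1 2 b w irrefl by (auto simp: closed_walk6_def dest: sym)
  then show ?thesis using b cf 2 by (auto simp: closed_walk6_def)
qed

text \<open>Reversing the hexagon turns the chord \<open>{b,d}\<close> into \<open>{c,a}\<close>, so
  this end needs its own argument. The edge \<open>{w,a}\<close> leaves only \<open>w = f\<close>:
  \<open>{a,d}\<close> is an antipodal chord, and \<open>{a,e}\<close> lies in the class opposite to
  \<open>{b,d}\<close>.\<close>

lemma crossed_contact_right:
  assumes 1: "closed_walk6 a b c d e f" and 2: "closed_walk6 a b d c v w"
    and v: "v \<notin> {a,b,c,d,e,f}" and w: "w \<in> {a,b,c,d,e,f}"
  shows "a \<noteq> d \<and> b \<noteq> e \<and> c \<noteq> f \<and> w = f \<and> adj b d"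
proof -
  have adj: "adj a b" "adj b c" "adj c d" "adj d e" "adj e f" "adj f a"
      "adj b d" "adj c v" "adj v w" "adj w a"
    and ne: "a \<noteq> c" "b \<noteq> d" "c \<noteq> e" "d \<noteq> f" "e \<noteq> a" "f \<noteq> b"
      "\<not> (a = d \<and> b = e)" "\<not> (b = e \<and> c = f)" "\<not> (c = f \<and> d = a)"
      "a \<noteq> d" "v \<noteq> a" "v \<noteq> d" "w \<noteq> b" "w \<noteq> c"
    using 1 2 by (auto simp: closed_walk6_def)
  note rot = closed_walk6_rotate2[OF 1] closed_walk6_rotate2[OF closed_walk6_rotate2[OF 1]]
  note adj = adj adj[THEN sym]
  have cf: "c \<noteq> f" using crossed_meeting[OF 1 2] by auto
  have "w \<noteq> a" "w \<noteq> d" using irrefl adj no_antipodal_chord[OF 1] by auto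
  moreover have "w \<noteq> e" using chords[OF rot(2)] adj ne cf by blast
  ultimately have wf: "w = f" using w ne by auto
  moreover have "b \<noteq> e" using unique_mid[of b c v f] adj ne v cf wf by auto
  ultimately show ?thesis using adj ne cf by auto
qed

text \<open>The ends are forced to be \<open>b\<close> and \<open>f\<close>, and then
  \<open>d\<close>, \<open>b\<close>, \<open>f\<close>, \<open>e\<close> is a 4-cycle unless
  \<open>b = e\<close>, that is, unless the edge is \<open>{e,f}\<close> itself.\<close>

lemma crossed_not_inside:
  assumes 1: "closed_walk6 a b c d e f" and 2: "closed_walk6 a b d c v w"
    and ef: "{v,w} \<noteq> {e,f}" and v: "v \<in> {a,b,c,d,e,f}" and w: "w \<in> {a,b,c,d,e,f}"
  shows False
proof -
  have adj: "adj a b" "adj b c" "adj c d" "adj d e" "adj e f" "adj f a"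
      "adj b d" "adj c v" "adj v w" "adj w a"
    and ne: "a \<noteq> c" "b \<noteq> d" "c \<noteq> e" "d \<noteq> f" "e \<noteq> a" "f \<noteq> b"
      "\<not> (a = d \<and> b = e)" "\<not> (b = e \<and> c = f)" "\<not> (c = f \<and> d = a)"
      "a \<noteq> d" "v \<noteq> a" "v \<noteq> d" "w \<noteq> b" "w \<noteq> c"
    using 1 2 by (auto simp: closed_walk6_def)
  note rot = closed_walk6_rotate2[OF 1] closed_walk6_rotate2[OF closed_walk6_rotate2[OF 1]]
  note adj = adj adj[THEN sym]
  have b: "v = b" and cf: "c \<noteq> f" using crossed_meeting[OF 1 2] v by auto
  have "w \<noteq> a" "w \<noteq> d" using irrefl adj no_antipodal_chord[OF 1] by auto
  moreover have "w \<noteq> e" using chords[OF rot(2)] adj ne cf by blast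
  ultimately have wf: "w = f" using w ne by auto
  with b ef have "b \<noteq> e" by auto
  then show False using c4[of d b f e] adj wf b ne by auto
qed

section \<open>Vertices at which a new edge leaves the walk\<close>

definition chorded_part :: "'v set \<Rightarrow> bool" where
  "chorded_part A \<longleftrightarrow> (\<exists>x\<in>A. \<exists>y\<in>A. adj x y)"

text \<open>Only the parity class carrying a chord is recorded, not the chord itself, so that the
  condition survives reversal of the walk and rotation by two steps.\<close>

definition hex_contact where
  "hex_contact a b c d e f x \<longleftrightarrow> a \<noteq> d \<and> b \<noteq> e \<and> c \<noteq> f \<and>
     (x \<in> {a,c,e} \<and> chorded_part {a,c,e} \<or> x \<in> {b,d,f} \<and> chorded_part {b,d,f})"

lemma hex_contact_flip: "hex_contact d c b a f e x \<longleftrightarrow> hex_contact a b c d e f x"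
  unfolding hex_contact_def chorded_part_def by blast

lemma hex_contact_rotate: "hex_contact c d e f a b x \<longleftrightarrow> hex_contact a b c d e f x"
  unfolding hex_contact_def chorded_part_def by blast

lemma parallel_or_crossed_contact:
  assumes 1: "closed_walk6 a b c d e f" and 2: "closed_walk6 a b c d v w \<or> closed_walk6 a b d c v w" and ef: "{v,w} \<noteq> {e,f}"
    and C: "C = {a,b,c,d,e,f}" and meets: "v \<in> C \<or> w \<in> C"
  shows "v \<in> C \<and> w \<notin> C \<and> hex_contact a b c d e f v \<or>
    w \<in> C \<and> v \<notin> C \<and> hex_contact a b c d e f w"
proof -
  have bf: "hex_contact a b c d e f x"
    if "a \<noteq> d \<and> b \<noteq> e \<and> c \<noteq> f \<and> (x = b \<and> adj b d \<or> x = f \<and> adj d f)"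
    for a b c d e f x
    using that sym unfolding hex_contact_def chorded_part_def by blast
  have bd: "hex_contact a b c d e f x"
    if "a \<noteq> d \<and> b \<noteq> e \<and> c \<noteq> f \<and> x \<in> {b, f} \<and> adj b d"
    for a b c d e f x
    using that sym unfolding hex_contact_def chorded_part_def by blast
  have C': "C = {d,c,b,a,f,e}" using C by blast
  show ?thesis
  proof (cases "closed_walk6 a b c d v w")
    case walk: True
    consider "v \<in> C" "w \<in> C" | "v \<in> C" "w \<notin> C" | "v \<notin> C" "w \<in> C" using meets by blast
    then show ?thesis
    proof cases
      case 1
      then show ?thesis using parallel_not_inside[OF \<open>closed_walk6 a b c d e f\<close> walk ef] by (simp add: C)
    next
      case 2
      then have "hex_contact a b c d e f v" using parallel_contact[OF 1 walk, folded C] by (intro bf) simp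
      with 2 show ?thesis by simp
    next
      case 3
      \<comment> \<open>Reversing both walks exchanges the roles of \<open>v\<close> and
        \<open>w\<close>.\<close>
      then have "hex_contact d c b a f e w"
        using parallel_contact[OF closed_walk6_flip[OF 1] closed_walk6_flip[OF walk], folded C'] by (intro bf) simp
      with 3 show ?thesis by (simp add: hex_contact_flip[of d c b a f e])
    qed
  next
    case False
    with 2 have walk: "closed_walk6 a b d c v w" by simp
    consider "v \<in> C" "w \<in> C" | "v \<in> C" "w \<notin> C" | "v \<notin> C" "w \<in> C" using meets by blast
    then show ?thesis
    proof cases
      case 1
      then show ?thesis using crossed_not_inside[OF \<open>closed_walk6 a b c d e f\<close> walk ef] by (simp add: C)
    next
      case 2
      then have "hex_contact a b c d e f v" using crossed_contact_left[OF 1 walk, folded C] by (intro bd) simp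
      with 2 show ?thesis by simp
    next
      case 3
      then have "hex_contact a b c d e f w" using crossed_contact_right[OF 1 walk, folded C] by (intro bd) simp
      with 3 show ?thesis by simp
    qed
  qed
qed

text \<open>Chords in both parity classes are impossible in a genuine hexagon, so \<open>x\<close>
  and \<open>y\<close> lie in one class and have a common neighbour on the walk. The outside vertex
  \<open>z\<close> would be a second one.\<close>

lemma hex_contact_contradiction:
  assumes 1: "closed_walk6 a b c d e f" and x: "hex_contact a b c d e f x" "hex_contact a b c d e f y" "x \<noteq> y"
    and z: "adj z x" "adj z y" "z \<notin> {a,b,c,d,e,f}"
  shows False
proof -
  have hex: "a \<noteq> d" "b \<noteq> e" "c \<noteq> f" using x by (auto simp: hex_contact_def)
  note rot = closed_walk6_rotate2[OF 1] closed_walk6_rotate2[OF closed_walk6_rotate2[OF 1]]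
  have chorded: "chorded_part {x,y,z} \<longleftrightarrow> adj x y \<or> adj y z \<or> adj x z" for x y z
    using irrefl sym unfolding chorded_part_def by blast
  have "\<not> (chorded_part {a,c,e} \<and> chorded_part {b,d,f})"
    unfolding chorded using chords[OF 1] chords[OF rot(1)] chords[OF rot(2)] hex sym by metis
  then have xy: "x \<in> {a,c,e} \<and> y \<in> {a,c,e} \<or> x \<in> {b,d,f} \<and> y \<in> {b,d,f}"
    using x by (auto simp: hex_contact_def)
  have edges: "adj a b" "adj b a" "adj b c" "adj c b" "adj c d" "adj d c" "adj d e" "adj e d"
    "adj e f" "adj f e" "adj f a" "adj a f"
    using 1 sym unfolding closed_walk6_def by blast+
  have "\<exists>m\<in>{a,b,c,d,e,f}. adj x m \<and> adj m y"
    using xy \<open>x \<noteq> y\<close> unfolding insert_iff empty_iff by (elim disjE conjE) (use edges in auto)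
  then show False
    using unique_mid[of x z y] x(3) z sym by blast
qed

text \<open>Of the four orientations of the two kept edges, one gives the parallel walk, one the
  crossed walk, one the crossed walk of the reversed hexagon, and the last would need the chord
  \<open>{a,d}\<close>.\<close>

lemma replacement_contact:
  assumes 1: "closed_walk6 a b c d e f" and 2: "closed_walk6 v w p q r s" and pq: "{p,q} = {a,b}" and rs: "{r,s} = {c,d}"
    and ef: "{v,w} \<noteq> {e,f}" and C: "C = {a,b,c,d,e,f}" and meets: "v \<in> C \<or> w \<in> C"
  shows "v \<in> C \<and> w \<notin> C \<and> hex_contact a b c d e f v \<or>
    w \<in> C \<and> v \<notin> C \<and> hex_contact a b c d e f w"
proof -
  note r = closed_walk6_rotate2[OF 2] and rev = closed_walk6_flip[OF 1]
  have ef': "{w,v} \<noteq> {f,e}" and C': "C = {d,c,b,a,f,e}" using ef C by blast+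
  consider "p = a" "q = b" "r = c" "s = d" | "p = a" "q = b" "r = d" "s = c"
    | "p = b" "q = a" "r = c" "s = d" | "p = b" "q = a" "r = d" "s = c"
    using pq rs by (auto simp: doubleton_eq_iff)
  then show ?thesis
  proof cases
    case 3
    have "closed_walk6 d c a b w v" using closed_walk6_flip[OF r] 3 by simp
    then have "w \<in> C \<and> v \<notin> C \<and> hex_contact d c b a f e w \<or> v \<in> C \<and> w \<notin> C \<and> hex_contact d c b a f e v"
      using parallel_or_crossed_contact[OF rev _ ef' C'] meets by blast
    then show ?thesis unfolding hex_contact_flip[of d c b a f e] by blast
  next
    case 4
    then show ?thesis using no_antipodal_chord[OF 1] r by (simp add: closed_walk6_def)
  next
    case 1
    with r have "closed_walk6 a b c d v w" by simp
    then show ?thesis using parallel_or_crossed_contact[OF assms(1) _ ef C meets] by blast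
  next
    case 2
    with r have "closed_walk6 a b d c v w" by simp
    then show ?thesis using parallel_or_crossed_contact[OF assms(1) _ ef C meets] by blast
  qed
qed

section \<open>Cubic binomials and the exchange of edges\<close>

definition cubic_pair :: "'v set multiset \<Rightarrow> 'v set multiset \<Rightarrow> bool" where
  "cubic_pair M N \<longleftrightarrow> size M = 3 \<and> size N = 3 \<and> set_mset M \<subseteq> E \<and> set_mset N \<subseteq> E \<and>
     (\<forall>v. edge_degree M v = edge_degree N v) \<and> set_mset M \<inter> set_mset N = {}"

lemma cubic_pair_walk:
  assumes MN: "cubic_pair M N" and p: "{v0, v1} \<in># M"
  obtains v2 v3 v4 v5 where "M = {#{v0, v1}, {v2, v3}, {v4, v5}#}" "N = {#{v1, v2}, {v3, v4}, {v5, v0}#}"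
    "closed_walk6 v0 v1 v2 v3 v4 v5"
proof -
  have c: "card e = 2" if "e \<in># M + N" for e
    using that MN card_edge by (auto simp: cubic_pair_def)
  have MN': "size M = 3" "size N = 3" "\<And>v. edge_degree M v = edge_degree N v" "set_mset M \<inter> set_mset N = {}"
    using MN by (auto simp: cubic_pair_def)
  obtain v2 v3 v4 v5 where v: "M = {#{v0, v1}, {v2, v3}, {v4, v5}#}" "N = {#{v1, v2}, {v3, v4}, {v5, v0}#}"
    by (rule cubic_fibre_walk[OF MN'(1,2) c MN'(3,4) p])
  have "closed_walk6 v0 v1 v2 v3 v4 v5"
    unfolding closed_walk6_def
  proof (intro conjI)
    show "adj v0 v1" "adj v1 v2" "adj v2 v3" "adj v3 v4" "adj v4 v5" "adj v5 v0"
      using MN by (simp_all add: cubic_pair_def adj_def v)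
    have ne: "x \<noteq> y" if "x \<in># M" "y \<in># N" for x y
      using MN'(4) that by blast
    show "v0 \<noteq> v2" using ne[of "{v0,v1}" "{v1,v2}"] by (auto simp: v)
    show "v1 \<noteq> v3" using ne[of "{v2,v3}" "{v1,v2}"] by (auto simp: v)
    show "v2 \<noteq> v4" using ne[of "{v2,v3}" "{v3,v4}"] by (auto simp: v)
    show "v3 \<noteq> v5" using ne[of "{v4,v5}" "{v3,v4}"] by (auto simp: v)
    show "v4 \<noteq> v0" using ne[of "{v4,v5}" "{v5,v0}"] by (auto simp: v)
    show "v5 \<noteq> v1" using ne[of "{v0,v1}" "{v5,v0}"] by (auto simp: v)
    show "\<not> (v0 = v3 \<and> v1 = v4)" using ne[of "{v0,v1}" "{v3,v4}"] by (auto simp: v)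
    show "\<not> (v1 = v4 \<and> v2 = v5)" using ne[of "{v4,v5}" "{v1,v2}"] by (auto simp: v)
    show "\<not> (v2 = v5 \<and> v3 = v0)" using ne[of "{v2,v3}" "{v5,v0}"] by (auto simp: v)
  qed
  with v that show thesis by blast
qed

text \<open>The edges of \<open>N\<close> join ends of \<open>g\<close> to ends of the two kept
  edges, or the kept edges to each other; hence they meet \<open>C\<close> and leave it only in ends
  of \<open>g\<close>.\<close>

lemma replace_edge:
  assumes 1: "closed_walk6 a b c d e f" and C: "C = {a,b,c,d,e,f}"
    and N: "cubic_pair {#g, {a,b}, {c,d}#} N" and ef: "g \<noteq> {e,f}"
  shows "(g \<inter> C = {} \<or> (\<exists>v w. g = {v,w} \<and> v \<in> C \<and> w \<notin> C \<and> hex_contact a b c d e f v)) \<and>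
    (\<forall>t\<in>#N. t \<inter> C \<noteq> {} \<and> t \<subseteq> g \<union> C)"
proof -
  have "card g = 2" using N card_edge by (auto simp: cubic_pair_def)
  then obtain v w where g: "g = {v,w}" by (auto simp: card_2_iff)
  then have vw: "{v,w} \<in># {#g, {a,b}, {c,d}#}" by simp
  obtain p q r s where M: "{#g, {a,b}, {c,d}#} = {#{v,w}, {p,q}, {r,s}#}"
    and N': "N = {#{w,p}, {q,r}, {s,v}#}" and w: "closed_walk6 v w p q r s"
    by (rule cubic_pair_walk[OF N vw])
  \<comment> \<open>The same walk traversed backwards covers the case where \<open>{r,s}\<close> is
    \<open>{a,b}\<close>.\<close>
  have w': "closed_walk6 w v s r q p" using closed_walk6_rotate2[OF closed_walk6_rotate2[OF closed_walk6_reverse[OF w]]] .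
  have "{#{a,b}, {c,d}#} = {#{p,q}, {r,s}#}" using M unfolding g by simp
  then have "{a,b} = {p,q} \<and> {c,d} = {r,s} \<or> {a,b} = {r,s} \<and> {c,d} = {p,q}"
    by (simp only: two_element_mset_eq_iff)
  moreover have "{s,r} = {r,s}" "{q,p} = {p,q}" by blast+
  ultimately have pqrs: "{p,q} = {a,b} \<and> {r,s} = {c,d} \<or> {s,r} = {a,b} \<and> {q,p} = {c,d}"
    by metis
  then have "{p,q,r,s} \<subseteq> C" unfolding C by (auto simp: doubleton_eq_iff)
  then have "\<forall>t\<in>#N. t \<inter> C \<noteq> {} \<and> t \<subseteq> g \<union> C" unfolding N' g by auto
  moreover have "g \<inter> C = {} \<or> (\<exists>v w. g = {v,w} \<and> v \<in> C \<and> w \<notin> C \<and> hex_contact a b c d e f v)"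
  proof (cases "v \<in> C \<or> w \<in> C")
    case True
    have vw': "{v,w} \<noteq> {e,f}" "{w,v} \<noteq> {e,f}" and True': "w \<in> C \<or> v \<in> C"
      using ef g True by (auto simp: insert_commute)
    have "v \<in> C \<and> w \<notin> C \<and> hex_contact a b c d e f v \<or>
    w \<in> C \<and> v \<notin> C \<and> hex_contact a b c d e f w"
      using pqrs replacement_contact[OF 1 w _ _ vw'(1) C True] replacement_contact[OF 1 w' _ _ vw'(2) C True'] by blast
    then show ?thesis unfolding g by blast
  qed (auto simp: g)
  ultimately show ?thesis by simp
qed

text \<open>The combinatorial contradiction, freed from syzygies: one replacement gives an edge of
  \<open>X\<close> meeting the walk, the next another such edge with the same outer end, against
  \<open>hex_contact_contradiction\<close>.\<close>

lemma no_exchange_closed_edge_set: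
  assumes UW: "cubic_pair U W" and "X \<noteq> {}" "X \<subseteq> E"
    and step: "\<And>g. g \<in> X \<Longrightarrow> \<exists>h N. h \<in># U \<and> h \<noteq> g \<and> cubic_pair (add_mset g (U - {#h#})) N \<and> set_mset N \<inter> X \<noteq> {}"
  shows False
proof -
  have "U \<noteq> {#}" using UW by (auto simp: cubic_pair_def)
  then obtain g0 where "g0 \<in># U" by auto
  moreover then have "card g0 = 2" using UW card_edge by (auto simp: cubic_pair_def)
  ultimately obtain a b where ab: "{a,b} \<in># U" by (auto simp: card_2_iff)
  obtain c d e f where U: "U = {#{a,b}, {c,d}, {e,f}#}" and walk: "closed_walk6 a b c d e f"
    by (rule cubic_pair_walk[OF UW ab])
  define C where "C = {a,b,c,d,e,f}"
  note rot = closed_walk6_rotate2[OF walk] closed_walk6_rotate2[OF closed_walk6_rotate2[OF walk]]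
  have step': "\<exists>t\<in>X. t \<noteq> g \<and> t \<inter> C \<noteq> {} \<and> t \<subseteq> g \<union> C \<and>
      (g \<inter> C = {} \<or> (\<exists>v w. g = {v,w} \<and> v \<in> C \<and> w \<notin> C \<and> hex_contact a b c d e f v))"
    if g: "g \<in> X" for g
  proof -
    obtain h N where h: "h \<in># U" "h \<noteq> g" and N: "cubic_pair (add_mset g (U - {#h#})) N"
      and X: "set_mset N \<inter> X \<noteq> {}"
      using step[OF g] by blast
    obtain t where t: "t \<in># N" "t \<in> X" using X by blast
    have "t \<noteq> g" using N t by (auto simp: cubic_pair_def)
    have "(g \<inter> C = {} \<or> (\<exists>v w. g = {v,w} \<and> v \<in> C \<and> w \<notin> C \<and> hex_contact a b c d e f v)) \<and>
      (\<forall>t\<in>#N. t \<inter> C \<noteq> {} \<and> t \<subseteq> g \<union> C)"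
    proof -
      \<comment> \<open>Rotation by two steps moves the replaced edge \<open>h\<close> to the last
        place.\<close>
      consider "h = {e,f}" | "h = {a,b}" | "h = {c,d}" using h U by auto
      then show ?thesis
      proof cases
        case 1
        have "U - {#h#} = {#{a,b}, {c,d}#}" unfolding U 1 by (simp add: add_mset_commute)
        then show ?thesis using replace_edge[OF walk C_def] N h(2) 1 by metis
      next
        case 2
        have U': "U - {#h#} = {#{c,d}, {e,f}#}" unfolding U 2 by simp
        have C: "C = {c,d,e,f,a,b}" unfolding C_def by blast
        have "g \<noteq> {a,b}" using h(2) 2 by blast
        from replace_edge[OF rot(1) C N[unfolded U'] this] show ?thesis
          unfolding hex_contact_rotate[of c d e f a b] .
      next
        case 3
        have U': "U - {#h#} = {#{e,f}, {a,b}#}" unfolding U 3 by (simp add: add_mset_commute)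
        have C: "C = {e,f,a,b,c,d}" unfolding C_def by blast
        have "g \<noteq> {c,d}" using h(2) 3 by blast
        from replace_edge[OF rot(2) C N[unfolded U'] this] show ?thesis
          unfolding hex_contact_rotate[of e f a b c d] hex_contact_rotate[of c d e f a b] .
      qed
    qed
    then show ?thesis using t(1) \<open>t \<noteq> g\<close> by (intro bexI[OF _ t(2)]) simp
  qed
  \<comment> \<open>The initial \<open>g\<close> may miss \<open>C\<close>. Its successor
    \<open>t\<close> meets \<open>C\<close>, so for \<open>t\<close> the first alternative in
    \<open>step'\<close> is ruled out.\<close>
  obtain g where "g \<in> X" using \<open>X \<noteq> {}\<close> by blast
  from step'[OF this] obtain t where t: "t \<in> X" "t \<inter> C \<noteq> {}" by (elim bexE conjE) (rule that)
  obtain x z where xz: "t = {x,z}" "x \<in> C" "z \<notin> C" "hex_contact a b c d e f x"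
    using step'[OF t(1)] t(2) by metis
  obtain t' where t': "t' \<in> X" "t' \<noteq> t" "t' \<inter> C \<noteq> {}" "t' \<subseteq> t \<union> C"
    using step'[OF t(1)] by (elim bexE conjE) (rule that)
  obtain x' z' where xz': "t' = {x',z'}" "x' \<in> C" "z' \<notin> C" "hex_contact a b c d e f x'"
    using step'[OF t'(1)] t'(3) by metis
  \<comment> \<open>\<open>z'\<close> lies in \<open>t\<close> but not in \<open>C\<close>, so it is
    \<open>z\<close>; as the edges differ, so do their ends on \<open>C\<close>.\<close>
  have "z' = z" using t'(4) xz xz' by auto
  moreover then have "x' \<noteq> x" using t'(2) xz xz' by auto
  moreover have "adj z x" "adj z' x'"
    using t(1) t'(1) \<open>X \<subseteq> E\<close> xz(1) xz'(1) by (auto simp: adj_def insert_commute)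
  ultimately show False
    using hex_contact_contradiction[OF walk xz(4) xz'(4)] xz(3) C_def by auto
qed

end

section \<open>Monomials and homogeneous polynomials\<close>

text \<open>Multisets of variables are in bijection with monomials and make it easy to take out one
  edge and to list the three edges of a cubic.\<close>

definition monom_of_mset :: "'x multiset \<Rightarrow> 'x monom" where
  "monom_of_mset M = (\<Sum>e\<in>#M. Poly_Mapping.single e 1)"

lemma monom_of_mset_simps [simp]:
  "monom_of_mset {#} = 0"
  "monom_of_mset (add_mset e M) = Poly_Mapping.single e 1 + monom_of_mset M"
  "monom_of_mset (M + N) = monom_of_mset M + monom_of_mset N"
  by (simp_all add: monom_of_mset_def)

lemma lookup_monom_of_mset: "lookup (monom_of_mset M) e = count M e"
  by (induction M) (auto simp: lookup_add lookup_single)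

lemma keys_monom_of_mset: "keys (monom_of_mset M) = set_mset M"
  by (auto simp: in_keys_iff lookup_monom_of_mset)

lemma mdeg_monom_of_mset: "mdeg (monom_of_mset M) = size M"
  by (simp add: mdeg_def keys_monom_of_mset lookup_monom_of_mset size_multiset_overloaded_eq)

lemma monom_of_mset_eq_iff [simp]: "monom_of_mset M = monom_of_mset N \<longleftrightarrow> M = N"
  by (metis lookup_monom_of_mset multiset_eq_iff)

lemma monom_of_mset_cases:
  obtains M where "m = monom_of_mset M"
proof
  have "finite {x. 0 < lookup m x}"
    using finite_keys[of m] by (simp add: keys.rep_eq)
  then show "m = monom_of_mset (Abs_multiset (lookup m))"
    by (intro poly_mapping_eqI) (simp add: lookup_monom_of_mset count_Abs_multiset)
qed

lemma mdeg_add: "mdeg (m + n) = mdeg m + mdeg n"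
  by (cases m rule: monom_of_mset_cases; cases n rule: monom_of_mset_cases)
    (simp add: mdeg_monom_of_mset flip: monom_of_mset_simps(3))

lemma mdeg_eq_0_iff: "mdeg m = 0 \<longleftrightarrow> m = 0"
  by (cases m rule: monom_of_mset_cases) (metis mdeg_monom_of_mset monom_of_mset_eq_iff monom_of_mset_simps(1) size_eq_0_iff_empty)

lemma mdeg_eq_1D: "mdeg m = 1 \<Longrightarrow> \<exists>e. m = Poly_Mapping.single e 1"
  by (cases m rule: monom_of_mset_cases) (metis add_0_right mdeg_monom_of_mset monom_of_mset_simps(1,2) size_1_singleton_mset)

section \<open>Coefficients of products with a homogeneous factor\<close>

lemma lookup_mult_keys:
  fixes p q :: "('x, 'k::comm_ring_1) mpoly"
  shows "lookup (p * q) m = (\<Sum>a\<in>keys p. \<Sum>b\<in>keys q. lookup p a * lookup q b when a + b = m)"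
proof -
  have "p * q = (\<Sum>a\<in>keys p. \<Sum>b\<in>keys q. Poly_Mapping.single (a + b) (lookup p a * lookup q b))"
    by (subst mpoly_sum_single[of p], subst mpoly_sum_single[of q])
      (simp add: sum_product mult_single)
  then show ?thesis by (simp add: lookup_sum lookup_single)
qed

lemma lookup_single_0_mult:
  fixes p :: "('x, 'k::comm_ring_1) mpoly"
  shows "lookup (Poly_Mapping.single 0 c * p) m = c * lookup p m"
proof (cases "c = 0")
  case False
  then show ?thesis by (simp add: lookup_mult_keys when_def in_keys_iff)
qed simp

text \<open>By degree, \<open>p\<close> can reach \<open>m\<close> only together with the constant
  term of \<open>q\<close>.\<close>

lemma lookup_mult_homogeneous:
  fixes p q :: "('x, 'k::comm_ring_1) mpoly"
  assumes p: "homogeneous (int (mdeg m)) p"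
  shows "lookup (p * q) m = lookup p m * lookup q 0"
proof -
  have iff: "a + b = m \<longleftrightarrow> a = m \<and> b = 0" if "a \<in> keys p" for a b
  proof -
    have "mdeg a = mdeg m" using p that by (auto simp: homogeneous_def)
    then show ?thesis using mdeg_add[of a b] mdeg_eq_0_iff[of b] by auto
  qed
  have "lookup (p * q) m = (\<Sum>a\<in>keys p. \<Sum>b\<in>keys q. lookup p a * lookup q b when a = m \<and> b = 0)"
    unfolding lookup_mult_keys by (intro sum.cong refl) (simp add: iff)
  also have "\<dots> = (\<Sum>a\<in>keys p. if a = m then \<Sum>b\<in>keys q. if b = 0 then lookup p a * lookup q b else 0 else 0)"
    by (intro sum.cong refl) (auto simp: when_def)
  also have "\<dots> = lookup p m * lookup q 0"
    by (simp add: in_keys_iff)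
  finally show ?thesis .
qed

text \<open>A linear \<open>q\<close> contains only variables, so \<open>m\<close> arises by
  splitting off one of its variables.\<close>

lemma lookup_mult_linear:
  fixes p q :: "('x, 'k::comm_ring_1) mpoly"
  assumes q: "homogeneous 1 q"
  shows "lookup (p * q) m =
    (\<Sum>e\<in>keys m. lookup p (m - Poly_Mapping.single e 1) * lookup q (Poly_Mapping.single e 1))"
proof -
  define V where "V = {e. Poly_Mapping.single e 1 \<in> keys q}"
  have inj: "inj_on (\<lambda>e. Poly_Mapping.single e (1::nat)) A" for A :: "'x set"
    by (rule inj_onI) (metis lookup_single_eq lookup_single_not_eq one_neq_zero)
  have keys_q: "keys q = (\<lambda>e. Poly_Mapping.single e 1) ` V"
    using q mdeg_eq_1D by (fastforce simp: V_def homogeneous_def)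
  have "finite V"
    using finite_keys[of q] inj unfolding keys_q by (rule finite_imageD)
  \<comment> \<open>Subtraction of monomials truncates at zero, so \<open>e\<close> must be required
    to occur in \<open>m\<close>.\<close>
  have split: "a + Poly_Mapping.single e 1 = m \<longleftrightarrow> e \<in> keys m \<and> a = m - Poly_Mapping.single e 1" for a e
  proof
    assume "a + Poly_Mapping.single e 1 = m"
    then show "e \<in> keys m \<and> a = m - Poly_Mapping.single e 1"
      by (auto simp: in_keys_iff lookup_add)
  next
    assume *: "e \<in> keys m \<and> a = m - Poly_Mapping.single e 1"
    then have "lookup m e > 0" by (simp add: in_keys_iff)
    then show "a + Poly_Mapping.single e 1 = m"
      using * by (intro poly_mapping_eqI) (auto simp: lookup_add lookup_minus lookup_single when_def)
  qed
  have "lookup (p * q) m = (\<Sum>e\<in>V. \<Sum>a\<in>keys p. lookup p a * lookup q (Poly_Mapping.single e 1)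
      when a + Poly_Mapping.single e 1 = m)"
    unfolding lookup_mult_keys
    by (subst sum.swap, unfold keys_q, subst sum.reindex[OF inj]) simp
  also have "\<dots> = (\<Sum>e\<in>V. if e \<in> keys m then
      lookup p (m - Poly_Mapping.single e 1) * lookup q (Poly_Mapping.single e 1) else 0)"
    unfolding split when_def by (intro sum.cong refl) (auto simp: in_keys_iff if_distrib cong: if_cong)
  also have "\<dots> = (\<Sum>e\<in>V \<inter> keys m. lookup p (m - Poly_Mapping.single e 1) * lookup q (Poly_Mapping.single e 1))"
    using \<open>finite V\<close> by (simp only: sum.inter_restrict)
  also have "\<dots> = (\<Sum>e\<in>keys m. lookup p (m - Poly_Mapping.single e 1) * lookup q (Poly_Mapping.single e 1))"
    by (rule sum.mono_neutral_left) (auto simp: V_def in_keys_iff)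
  finally show ?thesis .
qed

lemma poly_ring_simps [simp]:
  "0 \<in> poly_ring X" "(1::('x, 'k::comm_ring_1) mpoly) \<in> poly_ring X" "Poly_Mapping.single 0 c \<in> poly_ring X"
  by (auto simp: poly_ring_def)

lemma poly_ring_sum: "(\<And>a. a \<in> A \<Longrightarrow> f a \<in> poly_ring X) \<Longrightarrow> sum f A \<in> poly_ring X"
  by (induction A rule: infinite_finite_induct) (auto intro: poly_ring_add)

section \<open>Cubic presentations of toric ideals\<close>

text \<open>Generators and first syzygies are read off two differentials: \<open>f\<close> is the
  single row of \<open>D 0\<close> and \<open>L\<close> the matrix \<open>D 1\<close>. All twists
  are \<open>q\<close> in \<open>tw 1\<close> and \<open>q + 1\<close> in \<open>tw 2\<close>, so
  the entries of \<open>L\<close> have degree 1.\<close>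

lemma linear_resolution_presentation:
  fixes I :: "('x, 'k::comm_ring_1) mpoly set"
  assumes "has_linear_resolution q X I" and I: "I \<subseteq> poly_ring X"
  obtains r s :: nat and f :: "nat \<Rightarrow> ('x, 'k) mpoly" and L where
    "\<And>j. j < r \<Longrightarrow> f j \<in> I" "\<And>j. j < r \<Longrightarrow> homogeneous (int q) (f j)"
    "\<And>p. p \<in> I \<Longrightarrow> \<exists>v. (\<forall>j<r. v j \<in> poly_ring X) \<and> p = (\<Sum>j<r. f j * v j)"
    "\<And>j k. j < r \<Longrightarrow> k < s \<Longrightarrow> homogeneous 1 (L j k)"
    "\<And>k. k < s \<Longrightarrow> (\<Sum>j<r. f j * L j k) = 0"
    "\<And>v. (\<And>j. j < r \<Longrightarrow> v j \<in> poly_ring X) \<Longrightarrow> (\<Sum>j<r. f j * v j) = 0 \<Longrightarrow>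
       \<exists>w. \<forall>j<r. v j = (\<Sum>k<s. L j k * w k)"
proof -
  obtain tw and D :: "nat \<Rightarrow> ('x, 'k) mpoly mat" where
    res: "graded_free_resolution X I tw D"
    and betti: "\<And>i j. i \<ge> 1 \<Longrightarrow> j \<noteq> int q + int i - 1 \<Longrightarrow> graded_betti tw i j = 0"
    using assms(1) unfolding has_linear_resolution_def minimal_graded_free_resolution_def by blast
  define r where "r = length (tw 1)"
  define s where "s = length (tw 2)"
  let ?F = "\<lambda>n. free_module (poly_ring X) n :: ('x, 'k) mpoly vec set"
  have tw0: "tw 0 = [0]" and gr: "\<And>i. graded_matrix (poly_ring X) (tw i) (tw (Suc i)) (D i)"
    and im0: "(\<lambda>v. D 0 *\<^sub>v v) ` ?F r = {w \<in> ?F 1. w $ 0 \<in> I}"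
    and im1: "(\<lambda>v. D 1 *\<^sub>v v) ` ?F s = {w \<in> ?F r. D 0 *\<^sub>v w = 0\<^sub>v 1}"
    using res unfolding graded_free_resolution_def Let_def r_def s_def
    by (auto simp: numeral_2_eq_2)
  have D0: "D 0 \<in> carrier_mat 1 r" and D1: "D 1 \<in> carrier_mat r s"
    using gr[of 0] gr[of 1] by (auto simp: graded_matrix_def tw0 r_def s_def numeral_2_eq_2)
  have twist: "t = int q + int i - 1" if "t \<in> set (tw i)" "i \<ge> 1" for t i
    using betti[of i t] that by (auto simp: graded_betti_def count_list_0_iff)
  have tw1: "tw 1 ! j = int q" if "j < r" for j
    using twist[of "tw 1 ! j" 1] that by (simp add: r_def)
  have tw2: "tw 2 ! k = int q + 1" if "k < s" for k
    using twist[of "tw 2 ! k" 2] that by (simp add: s_def)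
  define f where "f = (\<lambda>j. D 0 $$ (0, j))"
  define L where "L = (\<lambda>j k. D 1 $$ (j, k))"
  have f: "f j \<in> poly_ring X" "homogeneous (int q) (f j)" if "j < r" for j
    using gr[of 0] that tw1[OF that] by (auto simp: graded_matrix_def tw0 r_def f_def)
  have L: "homogeneous 1 (L j k)" if "j < r" "k < s" for j k
  proof -
    have "homogeneous (tw 2 ! k - tw 1 ! j) (L j k)"
      using gr[of 1] that by (simp add: graded_matrix_def r_def s_def L_def numeral_2_eq_2)
    then show ?thesis unfolding tw1[OF that(1)] tw2[OF that(2)] by simp
  qed
  have mem_F: "vec n v \<in> ?F n \<longleftrightarrow> (\<forall>i<n. v i \<in> poly_ring X)" for n v
    by (auto simp: free_module_def vec_set_def)
  have F_cases: "\<exists>v. w = vec n v \<and> (\<forall>i<n. v i \<in> poly_ring X)" if "w \<in> ?F n" for w n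
  proof -
    have "w = vec n (($) w)" using that by (auto simp: free_module_def)
    then show ?thesis using that mem_F by metis
  qed
  have D0v: "D 0 *\<^sub>v vec r v = vec 1 (\<lambda>_. \<Sum>j<r. f j * v j)" for v
    using D0 by (intro eq_vecI) (auto simp: scalar_prod_def f_def lessThan_atLeast0)
  have D1v: "D 1 *\<^sub>v vec s w = vec r (\<lambda>j. \<Sum>k<s. L j k * w k)" for w
    using D1 by (intro eq_vecI) (auto simp: scalar_prod_def L_def lessThan_atLeast0)
  show thesis
  proof (rule that[of r f s L])
    fix j assume j: "j < r"
    let ?v = "\<lambda>i. if i = j then 1 else 0"
    have "D 0 *\<^sub>v vec r ?v \<in> {w \<in> ?F 1. w $ 0 \<in> I}"
      unfolding im0[symmetric] by (intro imageI) (simp add: mem_F)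
    then show "f j \<in> I" using j unfolding D0v by (simp add: if_distrib cong: if_cong)
  next
    fix p assume p: "p \<in> I"
    then have "vec 1 (\<lambda>_. p) \<in> {w \<in> ?F 1. w $ 0 \<in> I}"
      using I by (auto simp: mem_F)
    then obtain x where x: "x \<in> ?F r" "vec 1 (\<lambda>_. p) = D 0 *\<^sub>v x"
      unfolding im0[symmetric] by blast
    obtain v where v: "x = vec r v" "\<forall>i<r. v i \<in> poly_ring X"
      using F_cases[OF x(1)] by blast
    have "vec 1 (\<lambda>_. p) $ 0 = vec 1 (\<lambda>_. \<Sum>j<r. f j * v j) $ 0" 
      using x(2) unfolding v(1) D0v by simp
    then show "\<exists>v. (\<forall>j<r. v j \<in> poly_ring X) \<and> p = (\<Sum>j<r. f j * v j)"
      using v(2) by (intro exI[of _ v]) simp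
  next
    fix k assume k: "k < s"
    \<comment> \<open>This unit vector is mapped to column \<open>k\<close> of \<open>L\<close>,
      which lies in the kernel by exactness.\<close>
    let ?w = "\<lambda>i. if i = k then 1 else 0"
    have "D 1 *\<^sub>v vec s ?w \<in> {w \<in> ?F r. D 0 *\<^sub>v w = 0\<^sub>v 1}"
      unfolding im1[symmetric] by (intro imageI) (simp add: mem_F)
    then have "D 0 *\<^sub>v vec r (\<lambda>j. L j k) = 0\<^sub>v 1" using k unfolding D1v by (simp add: if_distrib cong: if_cong)
    then have "vec 1 (\<lambda>_. \<Sum>j<r. f j * L j k) $ 0 = 0\<^sub>v 1 $ 0" unfolding D0v by simp
    then show "(\<Sum>j<r. f j * L j k) = 0" by simp
  next
    fix v assume v: "\<And>j. j < r \<Longrightarrow> v j \<in> poly_ring X" "(\<Sum>j<r. f j * v j) = 0"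
    have "D 0 *\<^sub>v vec r v = 0\<^sub>v 1" unfolding D0v v(2) by auto
    then have "vec r v \<in> {w \<in> ?F r. D 0 *\<^sub>v w = 0\<^sub>v 1}" using v(1) by (simp add: mem_F)
    then obtain x where x: "x \<in> ?F s" "vec r v = D 1 *\<^sub>v x"
      unfolding im1[symmetric] by blast
    obtain w where w: "x = vec s w" using F_cases[OF x(1)] by blast
    have "v j = (\<Sum>k<s. L j k * w k)" if "j < r" for j
      using arg_cong[OF x(2), of "\<lambda>y. y $ j"] that unfolding w D1v by simp
    then show "\<exists>w. \<forall>j<r. v j = (\<Sum>k<s. L j k * w k)" by blast
  qed (use f L in auto)
qed

section \<open>Toric degrees and fibres of the toric map\<close>

definition toric_degree :: "'v set multiset \<Rightarrow> ('v \<Rightarrow>\<^sub>0 int) \<times> nat" where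
  "toric_degree M = (\<Sum>e\<in>#M. (\<rho> e, 1))"

lemma toric_degree_add_mset [simp]: "toric_degree (add_mset e M) = (\<rho> e, 1) + toric_degree M"
  by (simp add: toric_degree_def)

lemma toric_degree_empty [simp]: "toric_degree {#} = 0"
  by (simp add: toric_degree_def)

lemma toric_monom_of_mset:
  "toric_monom (monom_of_mset M) = (Poly_Mapping.single (toric_degree M) 1 :: ('v, 'k::comm_ring_1) laurent)"
proof (induction M)
  case empty
  then show ?case by (simp add: toric_monom_def zero_prod_def single_one[symmetric])
next
  case (add e M)
  have "toric_monom (monom_of_mset (add_mset e M)) =
      (edge_monomial e * toric_monom (monom_of_mset M) :: ('v, 'k) laurent)"
    by (simp only: monom_of_mset_simps toric_monom_add toric_monom_edge)
  then show ?case
    by (simp add: add edge_monomial_def mult_single)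
qed

lemma snd_toric_degree: "snd (toric_degree M) = size M"
  by (induction M) auto

lemma lookup_rho: "finite e \<Longrightarrow> lookup (\<rho> e) v = of_bool (v \<in> e)"
  by (simp add: \<rho>_def lookup_sum lookup_single when_def)

lemma lookup_fst_toric_degree:
  "(\<And>e. e \<in># M \<Longrightarrow> finite e) \<Longrightarrow> lookup (fst (toric_degree M)) v = int (edge_degree M v)"
  by (induction M) (auto simp: lookup_add lookup_rho)

text \<open>The exponent at a vertex counts the edges through it, and that of \<open>s\<close>
  counts all edges.\<close>

lemma toric_degree_eq_iff:
  assumes "\<And>e. e \<in># M + N \<Longrightarrow> finite e"
  shows "toric_degree M = toric_degree N \<longleftrightarrow> size M = size N \<and> (\<forall>v. edge_degree M v = edge_degree N v)"
proof -
  have "fst (toric_degree M) = fst (toric_degree N) \<longleftrightarrow> (\<forall>v. edge_degree M v = edge_degree N v)"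
    using assms by (auto simp: poly_mapping_eq_iff fun_eq_iff lookup_fst_toric_degree)
  then show ?thesis by (auto simp: prod_eq_iff snd_toric_degree)
qed

lemma lookup_toric_map:
  fixes p :: "('v set, 'k::comm_ring_1) mpoly"
  shows "lookup (toric_map p) d = (\<Sum>M\<in>{M. monom_of_mset M \<in> keys p}. lookup p (monom_of_mset M) when toric_degree M = d)"
proof -
  have keys: "keys p = monom_of_mset ` {M. monom_of_mset M \<in> keys p}"
    by (auto simp: image_iff) (metis monom_of_mset_cases)
  have "toric_map p = (\<Sum>m\<in>keys p. Poly_Mapping.single 0 (lookup p m) * toric_monom m)"
    by (simp add: toric_map_def toric_monom_def)
  also have "\<dots> = (\<Sum>M\<in>{M. monom_of_mset M \<in> keys p}. Poly_Mapping.single (toric_degree M) (lookup p (monom_of_mset M)))"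
    by (subst keys, subst sum.reindex)
      (auto simp: inj_on_def toric_monom_of_mset mult_single)
  finally show ?thesis by (simp add: lookup_sum lookup_single)
qed

text \<open>If \<open>M\<close> were alone in its fibre, the image of \<open>p\<close> would carry
  the nonzero coefficient of \<open>M\<close> at \<open>toric_degree M\<close>.\<close>

lemma toric_ideal_fibre:
  fixes p :: "('v set, 'k::comm_ring_1) mpoly"
  assumes p: "p \<in> toric_ideal E" and M: "monom_of_mset M \<in> keys p"
  obtains N where "monom_of_mset N \<in> keys p" "N \<noteq> M" "toric_degree N = toric_degree M"
proof (rule ccontr)
  assume "\<not> thesis"
  with that have uniq: "toric_degree N = toric_degree M \<longleftrightarrow> N = M" if "monom_of_mset N \<in> keys p" for N
    using \<open>monom_of_mset N \<in> keys p\<close> by blast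
  have fin: "finite {M. monom_of_mset M \<in> keys p}"
    using finite_vimageI[OF finite_keys[of p], of monom_of_mset] by (simp add: inj_def vimage_def)
  have "lookup (toric_map p) (toric_degree M) =
      (\<Sum>N\<in>{N. monom_of_mset N \<in> keys p}. if N = M then lookup p (monom_of_mset M) else 0)"
    unfolding lookup_toric_map by (intro sum.cong refl) (auto simp: uniq when_def)
  also have "\<dots> = lookup p (monom_of_mset M)" using fin M by simp
  finally show False using p M by (simp add: toric_ideal_def in_keys_iff)
qed

lemma toric_ideal_subset: "toric_ideal E \<subseteq> poly_ring E"
  by (auto simp: toric_ideal_def)

lemma toric_ideal_add: "p \<in> toric_ideal E \<Longrightarrow> q \<in> toric_ideal E \<Longrightarrow> p + q \<in> toric_ideal E"
  by (simp add: toric_ideal_def toric_map_add poly_ring_add)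

lemma toric_ideal_mult: "p \<in> toric_ideal E \<Longrightarrow> q \<in> poly_ring E \<Longrightarrow> q * p \<in> toric_ideal E"
  by (simp add: toric_ideal_def toric_map_mult poly_ring_mult)

section \<open>Binomials of the toric ideal\<close>

definition binomial :: "'x multiset \<Rightarrow> 'x multiset \<Rightarrow> ('x, 'k::comm_ring_1) mpoly" where
  "binomial M N = Poly_Mapping.single (monom_of_mset M) 1 + Poly_Mapping.single (monom_of_mset N) (-1)"

lemma lookup_binomial:
  "lookup (binomial M N) (monom_of_mset P) = ((1 when M = P) - (1 when N = P))"
  by (simp add: binomial_def lookup_add lookup_single when_def)

lemma keys_binomial: "keys (binomial M N) \<subseteq> {monom_of_mset M, monom_of_mset N}"
  unfolding binomial_def using Poly_Mapping.keys_add by (fastforce split: if_splits)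

lemma binomial_in_toric_ideal:
  assumes "toric_degree M = toric_degree N" "set_mset M \<subseteq> E" "set_mset N \<subseteq> E"
  shows "binomial M N \<in> (toric_ideal E :: ('v set, 'k::comm_ring_1) mpoly set)"
proof -
  have "toric_map (binomial M N) = (0 :: ('v, 'k) laurent)"
    using assms(1)
    by (simp add: binomial_def toric_map_add toric_map_single toric_monom_of_mset mult_single
        flip: single_add)
  moreover have "binomial M N \<in> poly_ring E"
    using keys_binomial[of M N] assms(2,3) by (auto simp: poly_ring_def keys_monom_of_mset dest!: subsetD)
  ultimately show ?thesis by (simp add: toric_ideal_def)
qed

lemma homogeneous_binomial: "size M = d \<Longrightarrow> size N = d \<Longrightarrow> homogeneous (int d) (binomial M N)"
  using keys_binomial[of M N] by (auto simp: homogeneous_def mdeg_monom_of_mset dest!: subsetD)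

section \<open>Toric ideals with cubic generators and linear syzygies\<close>

locale toric_presentation =
  fixes E :: "'v set set" and r s :: nat and f :: "nat \<Rightarrow> ('v set, 'k::field) mpoly"
    and L :: "nat \<Rightarrow> nat \<Rightarrow> ('v set, 'k) mpoly"
  assumes card_E: "e \<in> E \<Longrightarrow> card e = 2"
    and f_in: "j < r \<Longrightarrow> f j \<in> toric_ideal E" and f_hom: "j < r \<Longrightarrow> homogeneous 3 (f j)"
    and gen: "p \<in> toric_ideal E \<Longrightarrow> \<exists>v. (\<forall>j<r. v j \<in> poly_ring E) \<and> p = (\<Sum>j<r. f j * v j)"
    and L_hom: "j < r \<Longrightarrow> k < s \<Longrightarrow> homogeneous 1 (L j k)"
    and L_syz: "k < s \<Longrightarrow> (\<Sum>j<r. f j * L j k) = 0"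
    and syz: "(\<And>j. j < r \<Longrightarrow> v j \<in> poly_ring E) \<Longrightarrow> (\<Sum>j<r. f j * v j) = 0 \<Longrightarrow>
       \<exists>w. \<forall>j<r. v j = (\<Sum>k<s. L j k * w k)"
begin

lemma mdeg_ge_3:
  fixes p :: "('v set, 'k) mpoly"
  assumes "p \<in> toric_ideal E" "m \<in> keys p"
  shows "mdeg m \<ge> 3"
proof -
  obtain v where "p = (\<Sum>j<r. f j * v j)" using gen[OF assms(1)] by blast
  then obtain j where j: "j < r" "m \<in> keys (f j * v j)"
    using assms(2) keys_sum[of "\<lambda>j. f j * v j" "{..<r}"] by auto
  then obtain a b where "m = a + b" "a \<in> keys (f j)"
    using Poly_Mapping.keys_mult[of "f j" "v j"] by blast
  then show ?thesis using f_hom[OF j(1)] by (simp add: mdeg_add homogeneous_def)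
qed

text \<open>Otherwise the binomial of \<open>M\<close> and \<open>N\<close> would put a monomial of
  degree below 3 into an ideal generated by cubics.\<close>

lemma fibre_small:
  assumes "toric_degree M = toric_degree N" "set_mset M \<subseteq> E" "set_mset N \<subseteq> E" "size M < 3"
  shows "M = N"
proof (rule ccontr)
  assume "M \<noteq> N"
  then have "monom_of_mset M \<in> keys (binomial M N :: ('v set, 'k) mpoly)"
    by (simp add: in_keys_iff lookup_binomial)
  with mdeg_ge_3[OF binomial_in_toric_ideal[OF assms(1-3)]] assms(4) show False
    by (fastforce simp: mdeg_monom_of_mset)
qed

text \<open>The two pairs of opposite sides of a 4-cycle cover the same vertices, so they would be
  distinct members of one fibre in degree 2.\<close>

sublocale c4_free E
proof
  fix a b c d
  assume E: "{a, b} \<in> E" "{b, c} \<in> E" "{c, d} \<in> E" "{d, a} \<in> E"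
  then have ne: "a \<noteq> b" "b \<noteq> c" "c \<noteq> d" "d \<noteq> a" using card_E by fastforce+
  show "a = c \<or> b = d"
  proof (rule ccontr)
    assume *: "\<not> (a = c \<or> b = d)"
    have "toric_degree {#{a,b}, {c,d}#} = toric_degree {#{b,c}, {d,a}#}"
      using ne * by (simp add: \<rho>_def ac_simps)
    then have "{#{a,b}, {c,d}#} = {#{b,c}, {d,a}#}"
      using E by (intro fibre_small) auto
    then have "{a,b} \<in># {#{b,c}, {d,a}#}" by (metis union_single_eq_member add_mset_add_single)
    then show False using * by (auto simp: doubleton_eq_iff)
  qed
qed (rule card_E)

text \<open>A common edge could be cancelled, leaving two distinct members of one fibre in degree
  2.\<close>

lemma cubic_pairI:
  assumes "toric_degree M = toric_degree N" "set_mset M \<subseteq> E" "set_mset N \<subseteq> E" "size M = 3" "M \<noteq> N"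
  shows "cubic_pair M N"
proof -
  have fin: "finite e" if "e \<in># M + N" for e
  proof -
    have "e \<in> E" using that assms(2,3) by auto
    then show ?thesis using card_E[of e] by (metis card.infinite zero_neq_numeral)
  qed
  have "set_mset M \<inter> set_mset N = {}"
  proof (rule ccontr)
    assume "set_mset M \<inter> set_mset N \<noteq> {}"
    then obtain e where "e \<in># M" "e \<in># N" by blast
    then obtain M' N' where MN: "M = add_mset e M'" "N = add_mset e N'"
      by (metis multi_member_split)
    then have "M' = N'" using assms by (intro fibre_small) auto
    with MN \<open>M \<noteq> N\<close> show False by simp
  qed
  then show ?thesis
    using assms toric_degree_eq_iff[OF fin] by (auto simp: cubic_pair_def)
qed

text \<open>The set \<open>X\<close>: the variables of the linear forms obtained from the columns of
  \<open>L\<close> by weighting row \<open>j\<close> with the coefficient of \<open>u\<close> in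
  \<open>f j\<close>.\<close>

definition syzygy_vars :: "'v set monom \<Rightarrow> 'v set set" where
  "syzygy_vars u = {e. \<exists>k<s. (\<Sum>j<r. lookup (f j) u * lookup (L j k) (Poly_Mapping.single e 1)) \<noteq> 0}"

text \<open>The Koszul syzygy \<open>h \<cdot> g - g \<cdot> h = 0\<close> is a combination of linear syzygies. Weighting its components
  by \<open>[u]f\<^sub>j\<close> gives a polynomial whose coefficient at \<open>m\<close> is \<open>[m]h \<cdot> [u]g\<close>.\<close>

lemma koszul_meets_syzygy_vars:
  fixes g h :: "('v set, 'k) mpoly"
  assumes g: "g \<in> toric_ideal E" "homogeneous 3 g" "lookup g u \<noteq> 0" and u: "mdeg u = 3"
    and h: "h \<in> toric_ideal E" "homogeneous 3 h" "lookup h u = 0" and m: "m \<in> keys h"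
  shows "keys m \<inter> syzygy_vars u \<noteq> {}"
proof -
  obtain A where A: "\<And>j. j < r \<Longrightarrow> A j \<in> poly_ring E" "g = (\<Sum>j<r. f j * A j)" using gen[OF g(1)] by blast
  obtain B where B: "\<And>j. j < r \<Longrightarrow> B j \<in> poly_ring E" "h = (\<Sum>j<r. f j * B j)" using gen[OF h(1)] by blast
  let ?c = "\<lambda>j. Poly_Mapping.single 0 (lookup (f j) u) :: ('v set, 'k) mpoly"
  let ?v = "\<lambda>j. h * A j - g * B j"
  have v_in: "?v j \<in> poly_ring E" if "j < r" for j
  proof -
    have "g \<in> poly_ring E" "h \<in> poly_ring E" using g(1) h(1) toric_ideal_subset by auto
    then have "h * A j + (Poly_Mapping.single 0 (-1) * g) * B j \<in> poly_ring E"
      using A(1) B(1) that by (auto intro!: poly_ring_add poly_ring_mult)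
    then show ?thesis by (simp add: single_uminus)
  qed
  have "(\<Sum>j<r. f j * ?v j) = h * (\<Sum>j<r. f j * A j) - g * (\<Sum>j<r. f j * B j)"
    by (simp add: right_diff_distrib sum_subtractf sum_distrib_left mult_ac)
  then have "(\<Sum>j<r. f j * ?v j) = 0" by (simp flip: A(2) B(2))
  then obtain w where w: "\<And>j. j < r \<Longrightarrow> ?v j = (\<Sum>k<s. L j k * w k)"
    using syz[of ?v] v_in by blast
  let ?l = "\<lambda>k. \<Sum>j<r. ?c j * L j k"
  have hom3: "homogeneous (int (mdeg n)) p" if "homogeneous 3 p" "mdeg n = 3" for n and p :: "('v set, 'k) mpoly"
    using that by simp
  \<comment> \<open>Since \<open>f j\<close> has the degree of \<open>u\<close>, both sides see only
    the constant terms of the \<open>C j\<close>.\<close>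
  have const: "lookup (\<Sum>j<r. ?c j * C j) 0 = lookup (\<Sum>j<r. f j * C j) u" for C :: "nat \<Rightarrow> ('v set, 'k) mpoly"
  proof -
    have "lookup (?c j * C j) 0 = lookup (f j * C j) u" if "j < r" for j
      using lookup_mult_homogeneous[OF hom3[OF f_hom[OF that] u]]
        lookup_mult_homogeneous[of 0 "?c j" "C j"] by (simp add: homogeneous_def mdeg_def)
    then show ?thesis by (simp add: lookup_sum)
  qed
  have mdeg_m: "mdeg m = 3" using h(2) m by (simp add: homogeneous_def)
  have "(\<Sum>k<s. ?l k * w k) = (\<Sum>j<r. ?c j * (\<Sum>k<s. L j k * w k))"
    by (simp add: sum_distrib_left sum_distrib_right sum.swap[of _ "{..<s}"] mult.assoc)
  also have "\<dots> = (\<Sum>j<r. ?c j * ?v j)" by (intro sum.cong refl) (simp add: w)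
  also have "\<dots> = h * (\<Sum>j<r. ?c j * A j) - g * (\<Sum>j<r. ?c j * B j)"
    by (simp add: right_diff_distrib sum_subtractf sum_distrib_left mult_ac)
  \<comment> \<open>The product with \<open>g\<close> drops out, because the coefficient of
    \<open>u\<close> in \<open>h\<close> appears in it as a factor.\<close>
  finally have "lookup (\<Sum>k<s. ?l k * w k) m = lookup h m * lookup g u"
    using lookup_mult_homogeneous[OF hom3[OF h(2) mdeg_m]] lookup_mult_homogeneous[OF hom3[OF g(2) mdeg_m]] h(3)
    by (simp add: lookup_minus const A(2)[symmetric] B(2)[symmetric])
  then have "m \<in> keys (\<Sum>k<s. ?l k * w k)" using m g(3) by (simp add: in_keys_iff)
  then obtain k where k: "k < s" "m \<in> keys (?l k * w k)"
    using keys_sum[of "\<lambda>k. ?l k * w k" "{..<s}"] by auto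
  then obtain a b where ab: "m = a + b" "a \<in> keys (?l k)"
    using Poly_Mapping.keys_mult[of "?l k" "w k"] by blast
  have l: "lookup (?l k) a = (\<Sum>j<r. lookup (f j) u * lookup (L j k) a)" for a
    by (simp add: lookup_sum lookup_single_0_mult)
  have "\<exists>j<r. lookup (L j k) a \<noteq> 0"
    using ab(2) unfolding in_keys_iff l by (metis (mono_tags, lifting) lessThan_iff mult_zero_right sum.neutral)
  then have "mdeg a = 1" using L_hom k(1) by (fastforce simp: homogeneous_def in_keys_iff)
  then obtain e where e: "a = Poly_Mapping.single e 1" using mdeg_eq_1D by blast
  have "e \<in> syzygy_vars u" using ab(2) k(1) unfolding syzygy_vars_def in_keys_iff l e by blast
  moreover have "e \<in> keys m" unfolding ab(1) e by (simp add: in_keys_iff lookup_add)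
  ultimately show ?thesis by blast
qed

text \<open>In the coefficient of \<open>x\<^sub>e u\<close> in a linear syzygy the contribution of \<open>e\<close> must be cancelled by
  that of some other edge.\<close>

lemma syzygy_vars_exchange:
  assumes e: "e \<in> syzygy_vars (monom_of_mset U)"
  obtains e' j where "e' \<in># U" "e' \<noteq> e" "j < r" "monom_of_mset (add_mset e (U - {#e'#})) \<in> keys (f j)"
proof -
  obtain k where k: "k < s"
    and ne: "(\<Sum>j<r. lookup (f j) (monom_of_mset U) * lookup (L j k) (Poly_Mapping.single e 1)) \<noteq> 0"
    using e by (auto simp: syzygy_vars_def)
  define M where "M = add_mset e U"
  define T where "T = (\<lambda>e'. \<Sum>j<r. lookup (f j) (monom_of_mset (M - {#e'#})) * lookup (L j k) (Poly_Mapping.single e' 1))"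
  have minus: "monom_of_mset M - Poly_Mapping.single e' 1 = monom_of_mset (M - {#e'#})" if "e' \<in># M" for e'
    using that by (metis add_diff_cancel_left' insert_DiffM monom_of_mset_simps(2))
  have expand: "lookup (f j * L j k) (monom_of_mset M) =
      (\<Sum>e'\<in>set_mset M. lookup (f j) (monom_of_mset (M - {#e'#})) * lookup (L j k) (Poly_Mapping.single e' 1))"
    if "j < r" for j
    unfolding lookup_mult_linear[OF L_hom[OF that k]] keys_monom_of_mset
    by (intro sum.cong refl) (simp only: minus)
  have "0 = lookup (\<Sum>j<r. f j * L j k) (monom_of_mset M)" by (simp add: L_syz[OF k])
  also have "\<dots> = (\<Sum>j<r. \<Sum>e'\<in>set_mset M. lookup (f j) (monom_of_mset (M - {#e'#})) * lookup (L j k) (Poly_Mapping.single e' 1))"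
    unfolding lookup_sum
    by (intro sum.cong refl) (simp add: expand)
  also have "\<dots> = (\<Sum>e'\<in>set_mset M. T e')" unfolding T_def by (rule sum.swap)
  also have "\<dots> = T e + (\<Sum>e'\<in>set_mset M - {e}. T e')"
    by (rule sum.remove) (auto simp: M_def)
  \<comment> \<open>Removing \<open>e\<close> from \<open>M\<close> gives back \<open>U\<close>, so
    \<open>T e\<close> is the nonzero sum \<open>ne\<close> and the other terms must cancel
    it.\<close>
  finally have "(\<Sum>e'\<in>set_mset M - {e}. T e') \<noteq> 0"
    using ne by (auto simp: T_def M_def)
  then obtain e' where e': "e' \<in># M" "e' \<noteq> e" "T e' \<noteq> 0"
    by (metis (no_types, lifting) DiffD1 DiffD2 insertI1 sum.neutral)
  then obtain j where "j < r" "lookup (f j) (monom_of_mset (M - {#e'#})) \<noteq> 0"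
    unfolding T_def by (metis (mono_tags, lifting) lessThan_iff mult_zero_left sum.neutral)
  moreover have "M - {#e'#} = add_mset e (U - {#e'#})" "e' \<in># U" using e' by (auto simp: M_def)
  ultimately show thesis using that e'(2) by (simp add: in_keys_iff)
qed

text \<open>Any nonzero \<open>f i\<close> generates: were some \<open>f j\<close> not a scalar
  multiple of it, \<open>syzygy_vars u\<close> would contradict
  \<open>no_exchange_closed_edge_set\<close>.\<close>

lemma principal: "principal_ideal_of (poly_ring E) (toric_ideal E :: ('v set, 'k) mpoly set)"
proof (cases "\<exists>j<r. f j \<noteq> 0")
  case False
  have "p = 0" if "p \<in> toric_ideal E" for p :: "('v set, 'k) mpoly"
    using gen[OF that] False by auto
  moreover have "0 \<in> toric_ideal E" by (simp add: toric_ideal_def)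
  ultimately have "(toric_ideal E :: ('v set, 'k) mpoly set) = (\<lambda>g. g * 0) ` poly_ring E"
    by (auto simp: image_iff intro: poly_ring_simps(1))
  then show ?thesis unfolding principal_ideal_of_def by (intro bexI[of _ 0]) simp_all
next
  case True
  then obtain i where i: "i < r" "f i \<noteq> 0" by blast
  then obtain u where u: "u \<in> keys (f i)" by (metis keys_eq_empty ex_in_conv)
  obtain U where U: "u = monom_of_mset U" by (rule monom_of_mset_cases)
  have mdeg_u: "mdeg u = 3" using f_hom[OF i(1)] u by (simp add: homogeneous_def)
  have fiu: "lookup (f i) u \<noteq> 0" using u by (simp add: in_keys_iff)
  have keys_sub: "set_mset M \<subseteq> E" if "monom_of_mset M \<in> keys p" "p \<in> toric_ideal E"
    for M and p :: "('v set, 'k) mpoly"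
  proof -
    have "keys (monom_of_mset M) \<subseteq> E" using that by (auto simp: toric_ideal_def poly_ring_def)
    then show ?thesis by (simp add: keys_monom_of_mset)
  qed
  have pair: "\<exists>N. cubic_pair M N \<and> toric_degree M = toric_degree N" if M: "monom_of_mset M \<in> keys (f j)" and j: "j < r" for M j
  proof -
    obtain N where N: "monom_of_mset N \<in> keys (f j)" "N \<noteq> M" "toric_degree N = toric_degree M"
      by (rule toric_ideal_fibre[OF f_in[OF j] M])
    have "size M = 3" using f_hom[OF j] M by (simp add: homogeneous_def mdeg_monom_of_mset[symmetric])
    moreover have "set_mset M \<subseteq> E" "set_mset N \<subseteq> E"
      using keys_sub f_in[OF j] M N(1) by blast+
    ultimately show ?thesis using cubic_pairI[of M N] N(2,3) by auto
  qed
  let ?c = "\<lambda>j. lookup (f j) u / lookup (f i) u"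
  have mult: "f j = Poly_Mapping.single 0 (?c j) * f i" if j: "j < r" for j
  proof (rule ccontr)
    assume "f j \<noteq> Poly_Mapping.single 0 (?c j) * f i"
    \<comment> \<open>The scalar is chosen to cancel \<open>u\<close>, so \<open>h\<close> is a
      nonzero cubic of the ideal without \<open>u\<close>.\<close>
    define h where "h = f j + Poly_Mapping.single 0 (- ?c j) * f i"
    have "Poly_Mapping.single 0 (- ?c j) * f i = - (Poly_Mapping.single 0 (?c j) * f i)"
      by (simp add: single_uminus)
    then have "h \<noteq> 0" using \<open>f j \<noteq> _\<close> by (simp add: h_def)
    then obtain m where m: "m \<in> keys h" by (metis keys_eq_empty ex_in_conv)
    have h: "h \<in> toric_ideal E"
      unfolding h_def by (intro toric_ideal_add toric_ideal_mult f_in i j) simp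
    have "n \<in> keys (f i) \<union> keys (f j)" if "n \<in> keys h" for n
      using that by (auto simp: h_def in_keys_iff lookup_add lookup_single_0_mult)
    then have h3: "homogeneous 3 h"
      using f_hom[OF i(1)] f_hom[OF j] unfolding homogeneous_def by blast
    have hu: "lookup h u = 0" using fiu by (simp add: h_def lookup_add lookup_single_0_mult)
    have "keys m \<inter> syzygy_vars u \<noteq> {}"
      using koszul_meets_syzygy_vars[OF f_in[OF i(1)] f_hom[OF i(1)] fiu mdeg_u h h3 hu m] .
    moreover have "keys m \<subseteq> E" using m h by (auto simp: toric_ideal_def poly_ring_def)
    ultimately have X: "syzygy_vars u \<inter> E \<noteq> {}" by blast
    obtain W where UW: "cubic_pair U W" using pair[of U i] u i(1) U by blast
    show False
    proof (rule no_exchange_closed_edge_set[OF UW X])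
      fix g assume g: "g \<in> syzygy_vars u \<inter> E"
      then obtain e' l where e': "e' \<in># U" "e' \<noteq> g" "l < r"
        and l: "monom_of_mset (add_mset g (U - {#e'#})) \<in> keys (f l)"
        using syzygy_vars_exchange[of g U] U by blast
      let ?M = "add_mset g (U - {#e'#})"
      obtain N where N: "cubic_pair ?M N" "toric_degree ?M = toric_degree N" using pair[OF l e'(3)] by blast
      have sub: "set_mset ?M \<subseteq> E" "set_mset N \<subseteq> E" and size: "size ?M = 3" "size N = 3"
        and disj: "set_mset ?M \<inter> set_mset N = {}" using N(1) unfolding cubic_pair_def by blast+
      have MU: "?M \<noteq> U"
      proof
        assume "?M = U"
        moreover have "count ?M e' < count U e'" using e'(1,2) by simp
        ultimately show False by simp
      qed
      \<comment> \<open>Two edges of \<open>U\<close> remain in \<open>?M\<close>; \<open>N\<close>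
        avoids them and so differs from \<open>U\<close>.\<close>
      have "size (U - {#e'#}) = 2" using size(1) by simp
      then obtain x where x: "x \<in># U - {#e'#}" by (metis multiset_nonemptyE size_empty zero_neq_numeral)
      then have NU: "N \<noteq> U" using disj in_diffD[OF x] by auto
      \<comment> \<open>A cubic of the ideal without \<open>u\<close>, so its monomial
        \<open>N\<close> must involve a variable of \<open>syzygy_vars u\<close>.\<close>
      let ?b = "binomial ?M N :: ('v set, 'k) mpoly"
      have "monom_of_mset N \<in> keys ?b" 
        using disj x by (auto simp: in_keys_iff lookup_binomial when_def)
      moreover have "lookup ?b u = 0" using MU NU unfolding U lookup_binomial by simp
      moreover have "homogeneous 3 ?b" using homogeneous_binomial[OF size] by simp
      ultimately have "keys (monom_of_mset N) \<inter> syzygy_vars u \<noteq> {}"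
        using koszul_meets_syzygy_vars[OF f_in[OF i(1)] f_hom[OF i(1)] fiu mdeg_u binomial_in_toric_ideal[OF N(2) sub]]
        by blast
      then have "set_mset N \<inter> (syzygy_vars u \<inter> E) \<noteq> {}" using sub(2) by (auto simp: keys_monom_of_mset)
      then show "\<exists>h N. h \<in># U \<and> h \<noteq> g \<and> cubic_pair (add_mset g (U - {#h#})) N \<and> set_mset N \<inter> (syzygy_vars u \<inter> E) \<noteq> {}"
        using e' N(1) by blast
    qed blast
  qed
  have "toric_ideal E \<subseteq> (\<lambda>g. g * f i) ` poly_ring E"
  proof
    fix p :: "('v set, 'k) mpoly" assume "p \<in> toric_ideal E"
    then obtain v where v: "\<forall>j<r. v j \<in> poly_ring E" "p = (\<Sum>j<r. f j * v j)" using gen by blast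
    have "p = (\<Sum>j<r. (Poly_Mapping.single 0 (?c j) * f i) * v j)"
      unfolding v(2) by (intro sum.cong refl) (simp flip: mult)
    also have "\<dots> = (\<Sum>j<r. Poly_Mapping.single 0 (?c j) * v j) * f i"
      by (simp add: sum_distrib_left mult_ac)
    finally show "p \<in> (\<lambda>g. g * f i) ` poly_ring E"
      using v(1) by (auto intro!: imageI poly_ring_sum poly_ring_mult)
  qed
  then show ?thesis
    unfolding principal_ideal_of_def using f_in[OF i(1)] toric_ideal_subset toric_ideal_mult by blast
qed

end

theorem theorem0p1:
  fixes V :: "'v set" and E :: "'v set set"
  assumes "finite_simple_graph V E"
    and "connected_graph V E"
    and "E \<noteq> {}"
    and "has_linear_resolution 3 E (toric_ideal E :: ('v set, 'k::field) mpoly set)"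
  shows "principal_ideal_of (poly_ring E) (toric_ideal E :: ('v set, 'k) mpoly set)"
proof -
  have card: "card e = 2" if "e \<in> E" for e
    using assms(1) that by (simp add: finite_simple_graph_def)
  show ?thesis
  proof (rule linear_resolution_presentation[OF assms(4) toric_ideal_subset])
    fix r s :: nat and f :: "nat \<Rightarrow> ('v set, 'k) mpoly" and L :: "nat \<Rightarrow> nat \<Rightarrow> ('v set, 'k) mpoly"
    assume "\<And>j. j < r \<Longrightarrow> f j \<in> toric_ideal E" "\<And>j. j < r \<Longrightarrow> homogeneous (int 3) (f j)"
      "\<And>p. p \<in> toric_ideal E \<Longrightarrow> \<exists>v. (\<forall>j<r. v j \<in> poly_ring E) \<and> p = (\<Sum>j<r. f j * v j)"
      "\<And>j k. j < r \<Longrightarrow> k < s \<Longrightarrow> homogeneous 1 (L j k)"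
      "\<And>k. k < s \<Longrightarrow> (\<Sum>j<r. f j * L j k) = 0"
      "\<And>v. (\<And>j. j < r \<Longrightarrow> v j \<in> poly_ring E) \<Longrightarrow> (\<Sum>j<r. f j * v j) = 0 \<Longrightarrow>
         \<exists>w. \<forall>j<r. v j = (\<Sum>k<s. L j k * w k)"
    with card interpret toric_presentation E r s f L
      by unfold_locales simp_all
    show ?thesis by (rule principal)
  qed
qed

end
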